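(* Consider the generalized system $$u_{xt}+uu_{xx}=\lambda u_x^2-\lambda b_x^2+\kappa bb_{xx}+I(t),\qquad b_t+ub_x=\kappa bu_x,\qquad u_t+uu_x=-p_x+bb_x,$$ $$I(t)=(\lambda+\kappa)\|b_x(\cdot,t)\|_{L^2([0,1])}^2-(\lambda+1)\|u_x(\cdot,t)\|_{L^2([0,1])}^2,$$ for $0\le x\le1$, with smooth initial data $(u(x,0),b(x,0))=(u_0(x),b_0(x))$ and either the Dirichlet or the periodic boundary condition. Let $\gamma$ denote the associated Lagrangian trajectories and $\gamma_\alpha$ their Jacobian. If $\lambda=\kappa=0$, then solutions exist globally in time. In particular, for all $t\ge0$, the Jacobian satisfies $$\gamma_\alpha(\alpha,t)=e^{tu_0'(\alpha)}\left(\int_0^1e^{tu_0'(\alpha)}\,d\alpha\right)^{-1},$$ while $$b(\gamma(\alpha,t),t)=b_0(\alpha),\qquad 0\le u_0'(\alpha)-u_x(\gamma(\alpha,t),t)\le\int_0^1u_0'(\alpha)e^{tu_0'(\alpha)}\,d\alpha.$$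
   Context: $(u,b)$ is the solution with initial data $(u_0,b_0)$ ($p$ is the associated pressure). The Dirichlet boundary condition is $u(0,t)=u(1,t)=0$, $b(0,t)=b(1,t)=0$. The periodic boundary condition is $u(0,t)=u(1,t)$, $u_x(0,t)=u_x(1,t)$, $b(0,t)=b(1,t)$, $b_x(0,t)=b_x(1,t)$. The Lagrangian trajectories $\gamma(\alpha,t)$ are defined by $\gamma_t(\alpha,t)=u(\gamma(\alpha,t),t)$, $\gamma(\alpha,0)=\alpha$, for $\alpha\in[0,1]$. Their Jacobian is $\gamma_\alpha(\alpha,t)=\exp\left(\int_0^tu_x(\gamma(\alpha,s),s)\,ds\right)$. *)

theory Defs
  imports "HOL-Analysis.Analysis"
begin

datatype bdry = Dirichlet | Periodic

text \<open>Under the periodic condition trajectories may leave the unit interval, so functions on the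
  circle are represented by 1-periodic functions on the whole line. Under the Dirichlet condition
  only the values on the unit interval are used, and derivatives at 0 and 1 are one-sided.\<close>

definition space_dom :: "bdry \<Rightarrow> real set" where
  "space_dom bc = (case bc of Dirichlet \<Rightarrow> {0..1} | Periodic \<Rightarrow> UNIV)"

definition on_circle :: "bdry \<Rightarrow> (real \<Rightarrow> real) \<Rightarrow> bool" where
  "on_circle bc f \<longleftrightarrow> (bc = Periodic \<longrightarrow> (\<forall>x. f (x + 1) = f x))"

text \<open>A space-time function is written \<open>f x t\<close>. The derivatives below are only meaningful where
  they exist, which the smoothness requirements guarantee on the relevant sets.\<close>

definition deriv_on :: "real set \<Rightarrow> (real \<Rightarrow> real) \<Rightarrow> real \<Rightarrow> real" where
  "deriv_on S f x = vector_derivative f (at x within S)"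

definition Dx :: "real set \<Rightarrow> (real \<Rightarrow> real \<Rightarrow> real) \<Rightarrow> real \<Rightarrow> real \<Rightarrow> real" where
  "Dx S f x t = deriv_on S (\<lambda>y. f y t) x"

definition Dt :: "real set \<Rightarrow> (real \<Rightarrow> real \<Rightarrow> real) \<Rightarrow> real \<Rightarrow> real \<Rightarrow> real" where
  "Dt J f x t = deriv_on J (\<lambda>s. f x s) t"

text \<open>Smooth means infinitely differentiable, up to the end points that belong to the set.\<close>

coinductive smooth1 :: "real set \<Rightarrow> (real \<Rightarrow> real) \<Rightarrow> bool" for S where
  "\<lbrakk>\<forall>x\<in>S. (f has_real_derivative f' x) (at x within S); smooth1 S f'\<rbrakk> \<Longrightarrow> smooth1 S f"

text \<open>In two variables: all iterated mixed partial derivatives exist and are jointly continuous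
  (this is the largest class of continuous functions closed under both partial derivatives).\<close>

coinductive smooth2 :: "real set \<Rightarrow> real set \<Rightarrow> (real \<Rightarrow> real \<Rightarrow> real) \<Rightarrow> bool" for S J where
  "\<lbrakk>continuous_on (S \<times> J) (\<lambda>(x, t). f x t);
    \<forall>x\<in>S. \<forall>t\<in>J. ((\<lambda>y. f y t) has_real_derivative fx x t) (at x within S);
    \<forall>x\<in>S. \<forall>t\<in>J. ((\<lambda>s. f x s) has_real_derivative ft x t) (at t within J);
    smooth2 S J fx; smooth2 S J ft\<rbrakk> \<Longrightarrow> smooth2 S J f"

definition L2_norm :: "(real \<Rightarrow> real) \<Rightarrow> real" where
  "L2_norm f = sqrt (integral {0..1} (\<lambda>x. (f x)\<^sup>2))"

definition boundary_cond :: "bdry \<Rightarrow> (real \<Rightarrow> real) \<Rightarrow> bool" where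
  "boundary_cond bc f \<longleftrightarrow> (case bc of
     Dirichlet \<Rightarrow> f 0 = 0 \<and> f 1 = 0
   | Periodic \<Rightarrow> f 0 = f 1 \<and> deriv_on (space_dom bc) f 0 = deriv_on (space_dom bc) f 1)"

definition initial_data :: "bdry \<Rightarrow> (real \<Rightarrow> real) \<Rightarrow> (real \<Rightarrow> real) \<Rightarrow> bool" where
  "initial_data bc u\<^sub>0 b\<^sub>0 \<longleftrightarrow>
     smooth1 (space_dom bc) u\<^sub>0 \<and> on_circle bc u\<^sub>0 \<and> boundary_cond bc u\<^sub>0 \<and>
     smooth1 (space_dom bc) b\<^sub>0 \<and> on_circle bc b\<^sub>0 \<and> boundary_cond bc b\<^sub>0"

text \<open>Intervals of existence: either all nonnegative times or the times before some positive T.\<close>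

definition lifespan :: "real set \<Rightarrow> bool" where
  "lifespan J \<longleftrightarrow> J = {0..} \<or> (\<exists>T>0. J = {0..<T})"

definition nonlocal_term ::
  "real \<Rightarrow> real \<Rightarrow> real set \<Rightarrow> (real \<Rightarrow> real \<Rightarrow> real) \<Rightarrow> (real \<Rightarrow> real \<Rightarrow> real) \<Rightarrow> real \<Rightarrow> real" where
  "nonlocal_term lam kap S u b t =
     (lam + kap) * (L2_norm (\<lambda>x. Dx S b x t))\<^sup>2 - (lam + 1) * (L2_norm (\<lambda>x. Dx S u x t))\<^sup>2"

text \<open>No boundary condition is imposed on the pressure p.\<close>

definition solution ::
  "real \<Rightarrow> real \<Rightarrow> bdry \<Rightarrow> real set \<Rightarrow> (real \<Rightarrow> real) \<Rightarrow> (real \<Rightarrow> real) \<Rightarrow>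
   (real \<Rightarrow> real \<Rightarrow> real) \<Rightarrow> (real \<Rightarrow> real \<Rightarrow> real) \<Rightarrow> (real \<Rightarrow> real \<Rightarrow> real) \<Rightarrow> bool" where
  "solution lam kap bc J u\<^sub>0 b\<^sub>0 u b p \<longleftrightarrow>
     (let S = space_dom bc in
      smooth2 S J u \<and> smooth2 S J b \<and> smooth2 S J p \<and>
      (\<forall>x\<in>S. u x 0 = u\<^sub>0 x \<and> b x 0 = b\<^sub>0 x) \<and>
      (\<forall>t\<in>J. on_circle bc (\<lambda>x. u x t) \<and> boundary_cond bc (\<lambda>x. u x t) \<and>
             on_circle bc (\<lambda>x. b x t) \<and> boundary_cond bc (\<lambda>x. b x t)) \<and>
      (\<forall>x\<in>{0..1}. \<forall>t\<in>J.
         Dt J (Dx S u) x t + u x t * Dx S (Dx S u) x t =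
           lam * (Dx S u x t)\<^sup>2 - lam * (Dx S b x t)\<^sup>2 + kap * b x t * Dx S (Dx S b) x t
           + nonlocal_term lam kap S u b t \<and>
         Dt J b x t + u x t * Dx S b x t = kap * b x t * Dx S u x t \<and>
         Dt J u x t + u x t * Dx S u x t = - Dx S p x t + b x t * Dx S b x t))"

definition lagrangian ::
  "bdry \<Rightarrow> real set \<Rightarrow> (real \<Rightarrow> real \<Rightarrow> real) \<Rightarrow> (real \<Rightarrow> real \<Rightarrow> real) \<Rightarrow> bool" where
  "lagrangian bc J u \<gamma> \<longleftrightarrow>
     (\<forall>\<alpha>\<in>{0..1}. \<gamma> \<alpha> 0 = \<alpha> \<and>
        (\<forall>t\<in>J. \<gamma> \<alpha> t \<in> space_dom bc \<and>
           ((\<lambda>s. \<gamma> \<alpha> s) has_real_derivative u (\<gamma> \<alpha> t) t) (at t within J)))"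

end

theory Submission
  imports Defs
begin

text \<open>
  Differentiating along a trajectory turns the equation for \<open>u\<^sub>x\<close>, with both parameters equal to 0,
  into \<open>d/dt u\<^sub>x(\<gamma>(\<alpha>,t),t) = I(t)\<close>, whose right-hand side does not depend on the label \<open>\<alpha>\<close>. So
  \<open>u\<^sub>x(\<gamma>(\<alpha>,t),t) = u\<^sub>0'(\<alpha>) - K(t)\<close> for one function \<open>K\<close> of time, and
  \<open>\<gamma>\<^sub>\<alpha> = exp(t u\<^sub>0'(\<alpha>) - \<integral>\<^sub>0\<^sup>t K)\<close>. Under either boundary condition the image of \<open>[0,1]\<close> under the
  flow keeps length 1, which forces \<open>exp(\<integral>\<^sub>0\<^sup>t K) = M(t)\<close>, the integral of \<open>exp(t u\<^sub>0')\<close> over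
  \<open>[0,1]\<close>, and hence \<open>K = M'/M\<close>. As \<open>u\<^sub>0'\<close> has mean zero, \<open>M \<ge> 1\<close> and, for
  \<open>t \<ge> 0\<close>, \<open>M' \<ge> 0\<close>, so \<open>0 \<le> K \<le> M'\<close>. The equation for \<open>b\<close> says that \<open>b\<close> is constant along
  trajectories.

  Differentiability of \<open>\<gamma>\<close> in \<open>\<alpha>\<close> is part of the claim. It comes from the structure of the equation
  rather than from the general theory of dependence on initial values. Trajectories satisfy a
  two-sided Gronwall estimate (\<open>trajectories_distance\<close>), so \<open>\<gamma>(\<cdot>,t)\<close> is continuous and strictly increasing. Every point between
  two trajectories then lies on a trajectory with an intermediate label, where \<open>u\<^sub>x\<close> is known. This
  bounds the growth of the gap and gives an exact secant formula
  \<open>\<gamma>(\<beta>,t) - \<gamma>(\<alpha>,t) = (\<beta> - \<alpha>) exp(t u\<^sub>0'(e) - \<integral>\<^sub>0\<^sup>t K)\<close> with \<open>e\<close> between \<open>\<alpha>\<close> and \<open>\<beta>\<close>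
  (\<open>flow_secant\<close>), from which the derivative follows.

  For global existence, the formula for the Jacobian is taken as the definition of the flow:
  \<open>\<Phi>(a,t) = u\<^sub>0(0) t + (1/M(t)) \<integral>\<^sub>0\<^sup>a exp(t u\<^sub>0')\<close>. It is a bijection of the spatial domain at every time.
  With \<open>label(\<cdot>,t)\<close> its inverse, put \<open>u(x,t) = \<Phi>\<^sub>t(label(x,t),t)\<close> and \<open>b(x,t) = b\<^sub>0(label(x,t))\<close>.
  Then \<open>u\<^sub>x\<close> is \<open>u\<^sub>0' - M'/M\<close> at the label, so \<open>u\<^sub>x\<^sub>t + u u\<^sub>x\<^sub>x\<close> depends on time only. Integrating it
  over \<open>[0,1]\<close>, by parts in the second term, identifies it as \<open>- \<parallel>u\<^sub>x\<parallel>\<^sup>2\<close>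
  (\<open>Dt_grad_eq_nonlocal_term\<close>). The pressure is an antiderivative. What remains is smoothness, up to the
  boundary and for all mixed derivatives. It is proved by coinduction: a class of functions each of
  which has two partial derivatives again in the class is a class of smooth functions. Functions of
  the form \<open>h(label(x,t),t)\<close> with \<open>h\<close> smooth are such a class, as the derivatives of \<open>label\<close> are
  themselves of this form.
\<close>

section \<open>Mean values and one-sided derivatives\<close>

lemma field_derivative_compose_within:
  assumes "(f has_field_derivative D) (at (g x) within T)" "(g has_field_derivative E) (at x within S)"
    and "\<And>y. y \<in> S \<Longrightarrow> g y \<in> T"
  shows "((\<lambda>y. f (g y)) has_field_derivative D * E) (at x within S)"
proof -
  have "(f has_field_derivative D) (at (g x) within g ` S)"
    using assms(1) by (rule DERIV_subset) (use assms(3) in auto)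
  from DERIV_image_chain[OF this assms(2)] show ?thesis by (simp add: o_def)
qed

lemma real_mvt_within:
  assumes "a \<le> b" "\<And>x. x \<in> {a..b} \<Longrightarrow> (f has_real_derivative f' x) (at x within {a..b})"
  obtains c where "c \<in> {a..b}" "f b - f a = f' c * (b - a)"
  using mvt_very_simple[of a b f "\<lambda>x. (*) (f' x)"] assms
  by (auto simp: has_field_derivative_def)

lemma mono_from_derivative:
  assumes "a \<le> b" "\<And>x. x \<in> {a..b} \<Longrightarrow> (f has_real_derivative f' x) (at x within {a..b})"
    and "\<And>x. x \<in> {a..b} \<Longrightarrow> 0 \<le> f' x"
  shows "f a \<le> f (b::real)"
proof -
  obtain c where "c \<in> {a..b}" "f b - f a = f' c * (b - a)" using real_mvt_within[OF assms(1,2)] .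
  then show ?thesis using assms(1,3) by (metis diff_ge_0_iff_ge mult_nonneg_nonneg)
qed

text \<open>The segment form of the mean value theorem spares case distinctions on the order of \<open>x\<close> and
  \<open>y\<close>, and covers one-sided derivatives at the end points of \<open>S\<close>.\<close>
lemma mvt_segment:
  assumes S: "convex S" "x \<in> S" "y \<in> S"
    and f: "\<And>x. x \<in> S \<Longrightarrow> (f has_real_derivative f' x) (at x within S)"
  obtains c where "c \<in> closed_segment x y" "c \<in> S" "f y - f x = f' c * (y - x)"
proof -
  have seg: "closed_segment x y \<subseteq> S" using S by (simp add: closed_segment_subset)
  have *: "\<exists>c\<in>{a..b}. f b - f a = f' c * (b - a)" if "a \<le> b" "{a..b} \<subseteq> S" for a b
    by (metis real_mvt_within[OF that(1), of f f'] DERIV_subset[OF f that(2)] subsetD[OF that(2)])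
  show ?thesis
  proof (cases "x \<le> y")
    case True
    then show ?thesis using *[of x y] seg that by (auto simp: closed_segment_eq_real_ivl)
  next
    case False
    then obtain c where "c \<in> {y..x}" "f x - f y = f' c * (x - y)"
      using *[of y x] seg by (auto simp: closed_segment_eq_real_ivl)
    then show ?thesis using False seg that[of c]
      by (auto simp: closed_segment_eq_real_ivl algebra_simps)
  qed
qed

lemma filterlim_closed_segment:
  fixes l :: real
  assumes "(g \<longlongrightarrow> l) F" "\<forall>\<^sub>F y in F. c y \<in> closed_segment l (g y)"
  shows "(c \<longlongrightarrow> l) F"
proof (rule Lim_null_comparison[of "\<lambda>y. c y - l" "\<lambda>y. \<bar>g y - l\<bar>", THEN LIM_zero_cancel])
  show "\<forall>\<^sub>F y in F. norm (c y - l) \<le> \<bar>g y - l\<bar>"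
    using assms(2) by eventually_elim (auto simp: closed_segment_eq_real_ivl split: if_splits)
  show "((\<lambda>y. \<bar>g y - l\<bar>) \<longlongrightarrow> 0) F"
    using tendsto_rabs_zero[OF LIM_zero[OF assms(1)]] .
qed

text \<open>The point \<open>c\<close> is squeezed between \<open>x\<close> and \<open>y\<close>, so the difference quotients \<open>F c\<close> tend to
  \<open>F x\<close>. Both the Jacobian of a given flow and the derivative of the inverse flow arise from such exact
  secant formulas.\<close>
lemma derivative_from_secants:
  fixes f F :: "real \<Rightarrow> real"
  assumes x: "x \<in> S" and F: "(F \<longlongrightarrow> F x) (at x within S)"
    and sec: "\<And>y. y \<in> S \<Longrightarrow> \<exists>c\<in>closed_segment x y. c \<in> S \<and> f y - f x = (y - x) * F c"
  shows "(f has_real_derivative F x) (at x within S)"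
proof -
  obtain c where "\<forall>y\<in>S. c y \<in> closed_segment x y \<and> c y \<in> S \<and> f y - f x = (y - x) * F (c y)"
    using sec by metis
  then have c1: "\<forall>y\<in>S. c y \<in> closed_segment x y" and c2: "\<forall>y\<in>S. c y \<in> S"
    and c3: "\<forall>y\<in>S. f y - f x = (y - x) * F (c y)" by blast+
  have ev: "\<forall>\<^sub>F y in at x within S. y \<in> S \<and> y \<noteq> x" by (auto simp: eventually_at_filter)
  have lim: "(c \<longlongrightarrow> x) (at x within S)"
    by (rule filterlim_closed_segment[OF tendsto_ident_at], rule eventually_mono[OF ev]) (use c1 in blast)
  have cont: "continuous (at x within S) F" using F by (simp add: continuous_within)
  have "\<forall>\<^sub>F y in at x within S. c y \<in> S"
    using ev by (rule eventually_mono) (use c2 in blast)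
  from continuous_within_tendsto_compose[OF cont this lim]
  have "((\<lambda>y. F (c y)) \<longlongrightarrow> F x) (at x within S)" .
  moreover have "\<forall>\<^sub>F y in at x within S. F (c y) = (f y - f x) / (y - x)"
    using ev
  proof (rule eventually_mono)
    fix y assume "y \<in> S \<and> y \<noteq> x"
    then show "F (c y) = (f y - f x) / (y - x)" using bspec[OF c3, of y] by simp
  qed
  ultimately show ?thesis unfolding has_field_derivative_iff
    by (rule Lim_transform_eventually)
qed

section \<open>Smooth functions of space and time\<close>

text \<open>One unfolding step of \<^const>\<open>smooth2\<close>, separated out so that it can be proved for a candidate
  class of functions before these are known to be smooth.\<close>
definition partials ::
  "real set \<Rightarrow> real set \<Rightarrow> (real \<Rightarrow> real \<Rightarrow> real) \<Rightarrow> (real \<Rightarrow> real \<Rightarrow> real) \<Rightarrow> (real \<Rightarrow> real \<Rightarrow> real) \<Rightarrow> bool" where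
  "partials S J f fx ft \<longleftrightarrow>
     continuous_on (S \<times> J) (\<lambda>(x, t). f x t) \<and>
     (\<forall>x\<in>S. \<forall>t\<in>J. ((\<lambda>y. f y t) has_real_derivative fx x t) (at x within S)) \<and>
     (\<forall>x\<in>S. \<forall>t\<in>J. ((\<lambda>s. f x s) has_real_derivative ft x t) (at t within J))"

lemma partialsD:
  assumes "partials S J f fx ft"
  shows "continuous_on (S \<times> J) (\<lambda>(x, t). f x t)"
    and "\<And>x t. x \<in> S \<Longrightarrow> t \<in> J \<Longrightarrow> ((\<lambda>y. f y t) has_real_derivative fx x t) (at x within S)"
    and "\<And>x t. x \<in> S \<Longrightarrow> t \<in> J \<Longrightarrow> ((\<lambda>s. f x s) has_real_derivative ft x t) (at t within J)"
  using assms unfolding partials_def by blast+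

lemma smooth2_iff:
  "smooth2 S J f \<longleftrightarrow> (\<exists>fx ft. partials S J f fx ft \<and> smooth2 S J fx \<and> smooth2 S J ft)"
  by (subst smooth2.simps) (auto simp: partials_def)

text \<open>To prove smoothness it suffices to exhibit a class of functions that contains, with each
  function, its two partial derivatives.\<close>
lemma smooth2_coinduct:
  assumes "X f"
    and step: "\<And>f. X f \<Longrightarrow> \<exists>fx ft. partials S J f fx ft \<and> (X fx \<or> smooth2 S J fx) \<and> (X ft \<or> smooth2 S J ft)"
  shows "smooth2 S J f"
  using assms(1)
proof (coinduction arbitrary: f rule: smooth2.coinduct)
  case (smooth2 f)
  then obtain fx ft where "partials S J f fx ft" "X fx \<or> smooth2 S J fx" "X ft \<or> smooth2 S J ft"
    using step by blast
  then show ?case unfolding partials_def by (intro exI[of _ f] exI[of _ fx] exI[of _ ft]) simp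
qed

lemma continuous_on_smooth2: "smooth2 S J f \<Longrightarrow> continuous_on (S \<times> J) (\<lambda>(x, t). f x t)"
  unfolding smooth2_iff[of S J f] partials_def by blast

lemma partials_cong:
  assumes "partials S J f fx ft" and eq: "\<And>x t. x \<in> S \<Longrightarrow> t \<in> J \<Longrightarrow> g x t = f x t"
  shows "partials S J g fx ft"
  unfolding partials_def
proof (intro conjI ballI)
  show "continuous_on (S \<times> J) (\<lambda>(x, t). g x t)"
    using partialsD(1)[OF assms(1)] by (rule continuous_on_eq) (auto simp: eq)
  fix x t assume *: "x \<in> S" "t \<in> J"
  show "((\<lambda>y. g y t) has_real_derivative fx x t) (at x within S)"
    by (rule has_field_derivative_transform_within[OF partialsD(2)[OF assms(1) *], of 1]) (use * eq in auto)
  show "((\<lambda>s. g x s) has_real_derivative ft x t) (at t within J)"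
    by (rule has_field_derivative_transform_within[OF partialsD(3)[OF assms(1) *], of 1]) (use * eq in auto)
qed

lemma smooth2_cong:
  assumes "smooth2 S J f" "\<And>x t. x \<in> S \<Longrightarrow> t \<in> J \<Longrightarrow> g x t = f x t"
  shows "smooth2 S J g"
  using assms unfolding smooth2_iff[of S J f] smooth2_iff[of S J g] by (metis partials_cong)

lemma smooth2_const: "smooth2 S J (\<lambda>x t. c)"
  by (rule smooth2_coinduct[where X = "\<lambda>f. \<exists>c. f = (\<lambda>x t. c)"])
     (auto simp: partials_def intro!: exI[of _ "\<lambda>x t. 0"])

lemma smooth2_time: "smooth2 S J (\<lambda>x t. t)"
  unfolding smooth2_iff[of S J "\<lambda>x t. t"]
  by (rule exI[of _ "\<lambda>x t. 0"], rule exI[of _ "\<lambda>x t. 1"])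
     (auto simp: partials_def smooth2_const split_beta intro!: continuous_intros)

lemma smooth2_space:
  assumes "smooth1 S h"
  shows "smooth2 S J (\<lambda>x t. h x)"
proof (rule smooth2_coinduct[where X = "\<lambda>f. \<exists>h. smooth1 S h \<and> f = (\<lambda>x t. h x)"])
  show "\<exists>h'. smooth1 S h' \<and> (\<lambda>x t. h x) = (\<lambda>x t. h' x)" using assms by blast
next
  fix f :: "real \<Rightarrow> real \<Rightarrow> real" assume "\<exists>h. smooth1 S h \<and> f = (\<lambda>x t. h x)"
  then obtain h where h: "smooth1 S h" and f: "f = (\<lambda>x t. h x)" by blast
  from h obtain h' where h': "\<forall>x\<in>S. (h has_real_derivative h' x) (at x within S)" "smooth1 S h'"
    by (cases rule: smooth1.cases) blast
  have "continuous_on S h" using h'(1) by (intro DERIV_continuous_on) blast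
  then have "continuous_on (S \<times> J) (\<lambda>z. h (fst z))"
    by (rule continuous_on_compose2) (auto intro!: continuous_intros)
  then have "partials S J f (\<lambda>x t. h' x) (\<lambda>x t. 0)"
    using h'(1) by (auto simp: partials_def f split_beta)
  then show "\<exists>fx ft. partials S J f fx ft \<and>
      ((\<exists>h. smooth1 S h \<and> fx = (\<lambda>x t. h x)) \<or> smooth2 S J fx) \<and>
      ((\<exists>h. smooth1 S h \<and> ft = (\<lambda>x t. h x)) \<or> smooth2 S J ft)"
    using h'(2) smooth2_const by blast
qed

lemma smooth2_slice:
  assumes "smooth2 S J g" "c \<in> S"
  shows "smooth2 S J (\<lambda>x t. g c t)"
proof (rule smooth2_coinduct[where X = "\<lambda>f. \<exists>g. smooth2 S J g \<and> f = (\<lambda>x t. g c t)"])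
  show "\<exists>g'. smooth2 S J g' \<and> (\<lambda>x t. g c t) = (\<lambda>x t. g' c t)" using assms by blast
next
  fix f assume "\<exists>g. smooth2 S J g \<and> f = (\<lambda>(x::real) t. g c t)"
  then obtain g where g: "smooth2 S J g" and f: "f = (\<lambda>(x::real) t. g c t)" by blast
  from g obtain gx gt where p: "partials S J g gx gt" and gt: "smooth2 S J gt"
    unfolding smooth2_iff[of S J g] by blast
  have "continuous_on (S \<times> J) (\<lambda>z. (\<lambda>(x, t). g x t) (c, snd z))"
    by (rule continuous_on_compose2[OF partialsD(1)[OF p]])
       (auto intro!: continuous_intros simp: assms(2))
  then have "partials S J f (\<lambda>x t. 0) (\<lambda>x t. gt c t)"
    using partialsD(3)[OF p assms(2)] by (auto simp: partials_def f split_beta)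
  then show "\<exists>fx ft. partials S J f fx ft \<and>
      ((\<exists>g. smooth2 S J g \<and> fx = (\<lambda>x t. g c t)) \<or> smooth2 S J fx) \<and>
      ((\<exists>g. smooth2 S J g \<and> ft = (\<lambda>x t. g c t)) \<or> smooth2 S J ft)"
    using gt smooth2_const by blast
qed

text \<open>The product rule expresses the derivatives of a product through sums of other products, so the
  set of products of smooth functions is not closed under derivatives. The algebra generated by the
  smooth functions is, and therefore consists of smooth functions.\<close>
inductive smooth_alg :: "real set \<Rightarrow> real set \<Rightarrow> (real \<Rightarrow> real \<Rightarrow> real) \<Rightarrow> bool" for S J where
  base: "smooth2 S J f \<Longrightarrow> smooth_alg S J f"
| add: "smooth_alg S J f \<Longrightarrow> smooth_alg S J g \<Longrightarrow> smooth_alg S J (\<lambda>x t. f x t + g x t)"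
| mult: "smooth_alg S J f \<Longrightarrow> smooth_alg S J g \<Longrightarrow> smooth_alg S J (\<lambda>x t. f x t * g x t)"
| inverse: "smooth_alg S J f \<Longrightarrow> \<forall>x\<in>S. \<forall>t\<in>J. f x t \<noteq> 0 \<Longrightarrow> smooth_alg S J (\<lambda>x t. inverse (f x t))"
| exp: "smooth_alg S J f \<Longrightarrow> smooth_alg S J (\<lambda>x t. exp (f x t))"

lemma smooth_alg_partials:
  assumes "smooth_alg S J f"
  shows "\<exists>fx ft. partials S J f fx ft \<and> smooth_alg S J fx \<and> smooth_alg S J ft"
  using assms
proof induction
  case (base f)
  then show ?case unfolding smooth2_iff[of S J f] by (blast intro: smooth_alg.base)
next
  case (add f g)
  then obtain fx ft gx gt where
    f: "partials S J f fx ft" "smooth_alg S J fx" "smooth_alg S J ft" and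
    g: "partials S J g gx gt" "smooth_alg S J gx" "smooth_alg S J gt" by blast
  have "partials S J (\<lambda>x t. f x t + g x t) (\<lambda>x t. fx x t + gx x t) (\<lambda>x t. ft x t + gt x t)"
    using f(1) g(1) unfolding partials_def split_beta
    by (auto intro!: continuous_intros derivative_eq_intros)
  then show ?case using f g smooth_alg.add by blast
next
  case (mult f g)
  then obtain fx ft gx gt where
    f: "partials S J f fx ft" "smooth_alg S J fx" "smooth_alg S J ft" and
    g: "partials S J g gx gt" "smooth_alg S J gx" "smooth_alg S J gt" by blast
  have "partials S J (\<lambda>x t. f x t * g x t) (\<lambda>x t. fx x t * g x t + gx x t * f x t) (\<lambda>x t. ft x t * g x t + gt x t * f x t)"
    using f(1) g(1) unfolding partials_def split_beta
    by (auto intro!: continuous_intros DERIV_mult)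
  then show ?case using f g smooth_alg.add smooth_alg.mult mult.hyps by blast
next
  case (inverse f)
  then obtain fx ft where
    f: "partials S J f fx ft" "smooth_alg S J fx" "smooth_alg S J ft" by blast
  let ?q = "\<lambda>x t. inverse (f x t)"
  have "partials S J ?q (\<lambda>x t. (-1) * (?q x t * fx x t * ?q x t)) (\<lambda>x t. (-1) * (?q x t * ft x t * ?q x t))"
    using f(1) inverse.hyps(2) unfolding partials_def split_beta
    by (auto intro!: continuous_intros DERIV_inverse'[THEN DERIV_cong])
  moreover have "smooth_alg S J (\<lambda>x t. (-1) * (?q x t * h x t * ?q x t))" if "smooth_alg S J h" for h
    using that inverse.hyps
    by (intro smooth_alg.mult smooth_alg.inverse smooth_alg.base[OF smooth2_const[of _ _ "-1"]])
  ultimately show ?case using f by blast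
next
  case (exp f)
  then obtain fx ft where
    f: "partials S J f fx ft" "smooth_alg S J fx" "smooth_alg S J ft" by blast
  have "partials S J (\<lambda>x t. exp (f x t)) (\<lambda>x t. exp (f x t) * fx x t) (\<lambda>x t. exp (f x t) * ft x t)"
    using f(1) unfolding partials_def split_beta
    by (auto intro!: continuous_intros DERIV_chain2[OF DERIV_exp])
  then show ?case using f smooth_alg.mult smooth_alg.exp exp.hyps by blast
qed

lemma smooth2_alg: "smooth_alg S J f \<Longrightarrow> smooth2 S J f"
  by (rule smooth2_coinduct[where X = "smooth_alg S J"]) (use smooth_alg_partials in blast)+

lemma smooth2_add: "smooth2 S J f \<Longrightarrow> smooth2 S J g \<Longrightarrow> smooth2 S J (\<lambda>x t. f x t + g x t)"
  and smooth2_mult: "smooth2 S J f \<Longrightarrow> smooth2 S J g \<Longrightarrow> smooth2 S J (\<lambda>x t. f x t * g x t)"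
  and smooth2_exp: "smooth2 S J f \<Longrightarrow> smooth2 S J (\<lambda>x t. exp (f x t))"
  by (blast intro: smooth2_alg smooth_alg.intros)+

lemma smooth2_diff:
  assumes "smooth2 S J f" "smooth2 S J g" shows "smooth2 S J (\<lambda>x t. f x t - g x t)"
  using smooth2_add[OF assms(1) smooth2_mult[OF smooth2_const[of _ _ "-1"] assms(2)]] by simp

lemma smooth2_divide:
  assumes "smooth2 S J f" "smooth2 S J g" "\<And>x t. x \<in> S \<Longrightarrow> t \<in> J \<Longrightarrow> g x t \<noteq> 0"
  shows "smooth2 S J (\<lambda>x t. f x t / g x t)"
  unfolding divide_inverse using assms
  by (intro smooth2_mult smooth2_alg[OF smooth_alg.inverse] smooth_alg.base) auto

lemmas smooth2_intros = smooth2_const smooth2_time smooth2_add smooth2_mult smooth2_exp smooth2_diff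

lemma deriv_on_eq:
  assumes "x islimpt S" "(f has_real_derivative d) (at x within S)"
  shows "deriv_on S f x = d"
  unfolding deriv_on_def
  by (rule vector_derivative_within)
     (use assms in \<open>auto simp: trivial_limit_within has_real_derivative_iff_has_vector_derivative\<close>)

text \<open>The absence of isolated points makes one-sided derivatives unique, so that \<^const>\<open>Dx\<close> and
  \<^const>\<open>Dt\<close> compute them. Convexity serves the mean value theorem and Leibniz's rule, and together with
  \<open>0 \<in> S\<close> it makes \<open>S\<close> star-shaped about the origin.\<close>
locale region =
  fixes S J :: "real set"
  assumes convex_S: "convex S" and convex_J: "convex J"
    and perfect_S: "\<And>x. x \<in> S \<Longrightarrow> x islimpt S" and perfect_J: "\<And>t. t \<in> J \<Longrightarrow> t islimpt J"
    and zero_S: "0 \<in> S"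
begin

lemma Dx_eq:
  assumes "x \<in> S" "((\<lambda>y. f y t) has_real_derivative d) (at x within S)"
  shows "Dx S f x t = d"
  unfolding Dx_def using assms perfect_S by (intro deriv_on_eq)

lemma Dt_eq:
  assumes "t \<in> J" "((\<lambda>s. f x s) has_real_derivative d) (at t within J)"
  shows "Dt J f x t = d"
  unfolding Dt_def using assms perfect_J by (intro deriv_on_eq)

lemma partials_unique:
  assumes "partials S J f fx ft" "x \<in> S" "t \<in> J"
  shows "Dx S f x t = fx x t" "Dt J f x t = ft x t"
  using assms partialsD(2,3)[OF assms] by (auto intro: Dx_eq Dt_eq)

lemma smooth2D:
  assumes "smooth2 S J f"
  shows smooth2_partials: "partials S J f (Dx S f) (Dt J f)"
    and smooth2_Dx: "smooth2 S J (Dx S f)"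
    and smooth2_Dt: "smooth2 S J (Dt J f)"
proof -
  from assms obtain fx ft where p: "partials S J f fx ft" and s: "smooth2 S J fx" "smooth2 S J ft"
    unfolding smooth2_iff[of S J f] by blast
  note eq = partials_unique[OF p]
  show "partials S J f (Dx S f) (Dt J f)"
    using p eq unfolding partials_def by simp
  show "smooth2 S J (Dx S f)" "smooth2 S J (Dt J f)"
    using s eq by (auto intro: smooth2_cong)
qed

lemmas has_derivative_Dx = partialsD(2)[OF smooth2_partials]
lemmas has_derivative_Dt = partialsD(3)[OF smooth2_partials]

text \<open>The chain rule for the material derivative. Continuity of the partial derivative in space makes
  \<open>f\<close> totally differentiable within \<open>J \<times> S\<close>, which the separate partial derivatives alone do not.\<close>
lemma has_derivative_along_curve:
  assumes f: "smooth2 S J f" and t: "t \<in> J" and y: "\<And>s. s \<in> J \<Longrightarrow> y s \<in> S"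
    and y': "(y has_real_derivative d) (at t within J)"
  shows "((\<lambda>s. f (y s) s) has_real_derivative Dx S f (y t) t * d + Dt J f (y t) t) (at t within J)"
proof -
  let ?F = "\<lambda>(s, x). f x s"
  have cont: "continuous_on (J \<times> S) (\<lambda>z. blinfun_mult_right (Dx S f (snd z) (fst z)))"
  proof (intro bounded_linear.continuous_on[OF bounded_linear_blinfun_mult_right])
    show "continuous_on (J \<times> S) (\<lambda>z. Dx S f (snd z) (fst z))"
      by (rule continuous_on_compose2[OF continuous_on_smooth2[OF smooth2_Dx[OF f]],
            of "J \<times> S" "\<lambda>z. (snd z, fst z)", simplified])
         (auto intro!: continuous_intros)
  qed
  have "(?F has_derivative (\<lambda>(ds, dx). Dt J f (y t) t * ds + blinfun_mult_right (Dx S f (y t) t) dx))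
     (at (t, y t) within J \<times> S)"
  proof (rule has_derivative_partialsI)
    show "((\<lambda>s. f (y t) s) has_derivative (*) (Dt J f (y t) t)) (at t within J)"
      using has_derivative_Dt[OF f y[OF t] t] by (simp add: has_field_derivative_def)
    show "((\<lambda>x. f x s) has_derivative blinfun_mult_right (Dx S f x s)) (at x within S)"
      if "s \<in> J" "x \<in> S" for s x
      using has_derivative_Dx[OF f that(2,1)] by (simp add: has_field_derivative_def)
  qed (use t y convex_S cont[unfolded continuous_on_eq_continuous_within] in \<open>auto simp: case_prod_unfold\<close>)
  then have 1: "(?F has_derivative (\<lambda>(ds, dx). Dt J f (y t) t * ds + Dx S f (y t) t * dx))
     (at (t, y t) within (\<lambda>s. (s, y s)) ` J)"
    by (rule has_derivative_subset[THEN has_derivative_eq_rhs]) (use y in auto)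
  have "((\<lambda>s. (s, y s)) has_derivative (\<lambda>h. (h, d * h))) (at t within J)"
    using y' by (auto simp: has_field_derivative_def intro!: derivative_eq_intros)
  from diff_chain_within[OF this 1]
  show ?thesis
    by (simp add: o_def has_field_derivative_def) (auto simp: algebra_simps elim!: has_derivative_eq_rhs)
qed

lemma scaled_mem_S: "r \<in> {0..1} \<Longrightarrow> x \<in> S \<Longrightarrow> r * x \<in> S"
  using convexD[OF convex_S _ zero_S, of x r "1 - r"] by auto

text \<open>The antiderivative \<open>\<integral>\<^sub>0\<^sup>x g(y,t) dy\<close>, rescaled to the fixed interval \<open>[0,1]\<close>. In this form it makes
  sense for negative \<open>x\<close> as well, and Leibniz's rule applies to both variables.\<close>
definition prim :: "(real \<Rightarrow> real \<Rightarrow> real) \<Rightarrow> real \<Rightarrow> real \<Rightarrow> real" where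
  "prim g x t = integral {0..1} (\<lambda>r. x * g (r * x) t)"

lemma prim_0: "prim g 0 t = 0" and prim_1: "prim g 1 t = integral {0..1} (\<lambda>x. g x t)"
  by (simp_all add: prim_def)

text \<open>Differentiating the rescaled integrand in \<open>x\<close> gives the derivative of \<open>r g(r x,t)\<close> with respect
  to \<open>r\<close>, so the integral over \<open>[0,1]\<close> collapses to \<open>g(x,t)\<close>.\<close>
lemma partials_prim:
  assumes g: "smooth2 S J g"
  shows "partials S J (prim g) g (prim (Dt J g))"
  unfolding partials_def
proof (intro conjI ballI)
  have cont_scaled: "continuous_on T (\<lambda>z. h (c z * a z) (b z))"
    if "smooth2 S J h" "continuous_on T a" "continuous_on T b" "continuous_on T c"
      "\<And>z. z \<in> T \<Longrightarrow> a z \<in> S \<and> b z \<in> J \<and> c z \<in> {0..1}"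
    for h and T :: "'a::topological_space set" and a b c :: "'a \<Rightarrow> real"
    by (rule continuous_on_compose2[OF continuous_on_smooth2[OF that(1)],
            of T "\<lambda>z. (c z * a z, b z)", simplified])
       (use that(2-5) scaled_mem_S in \<open>auto intro!: continuous_intros\<close>)
  have "continuous_on (S \<times> J) (\<lambda>z. integral (cbox 0 1) (\<lambda>r. fst z * g (r * fst z) (snd z)))"
    by (rule integral_continuous_on_param)
       (auto simp: split_beta intro!: continuous_intros cont_scaled[OF g])
  then show "continuous_on (S \<times> J) (\<lambda>(x, t). prim g x t)"
    by (simp add: prim_def split_beta)
  have scaled_deriv: "((\<lambda>x. g (r * x) t) has_real_derivative Dx S g (r * x) t * r) (at x within S)"
    if "x \<in> S" "t \<in> J" "r \<in> {0..1}" for x t r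
    by (rule field_derivative_compose_within[OF has_derivative_Dx[OF g]])
       (use that scaled_mem_S in \<open>auto intro!: derivative_eq_intros\<close>)
  have scaled_deriv': "((\<lambda>r. g (r * x) t) has_real_derivative Dx S g (r * x) t * x) (at r within {0..1})"
    if "x \<in> S" "t \<in> J" "r \<in> {0..1}" for x t r
    by (rule field_derivative_compose_within[OF has_derivative_Dx[OF g]])
       (use that scaled_mem_S in \<open>auto intro!: derivative_eq_intros\<close>)
  fix x t assume x: "x \<in> S" and t: "t \<in> J"
  let ?d = "\<lambda>x r. g (r * x) t + Dx S g (r * x) t * r * x"
  have "((\<lambda>x. integral (cbox 0 1) (\<lambda>r. x * g (r * x) t)) has_real_derivative
      integral (cbox 0 1) (?d x)) (at x within S)"
  proof (rule leibniz_rule_field_derivative[OF _ _ _ x convex_S])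
    show "((\<lambda>x. x * g (r * x) t) has_real_derivative ?d x r) (at x within S)"
      if "x \<in> S" "r \<in> cbox 0 1" for x r
      using that t by (auto intro!: derivative_eq_intros scaled_deriv)
    show "(\<lambda>r. x * g (r * x) t) integrable_on cbox 0 1" if "x \<in> S" for x
      using that t by (intro integrable_continuous continuous_intros cont_scaled[OF g]) auto
    show "continuous_on (S \<times> cbox 0 1) (\<lambda>(x, r). ?d x r)"
      using t by (auto simp: split_beta intro!: continuous_intros cont_scaled[OF g] cont_scaled[OF smooth2_Dx[OF g]])
  qed
  moreover have "(?d x has_integral 1 * g (1 * x) t - 0 * g (0 * x) t) {0..1}"
    by (rule fundamental_theorem_of_calculus)
       (use x t in \<open>auto simp: has_real_derivative_iff_has_vector_derivative[symmetric] algebra_simps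
          intro!: derivative_eq_intros scaled_deriv'\<close>)
  ultimately show "((\<lambda>y. prim g y t) has_real_derivative g x t) (at x within S)"
    by (simp add: prim_def integral_unique)
  have "((\<lambda>t. integral (cbox 0 1) (\<lambda>r. x * g (r * x) t)) has_real_derivative
      integral (cbox 0 1) (\<lambda>r. x * Dt J g (r * x) t)) (at t within J)"
  proof (rule leibniz_rule_field_derivative[OF _ _ _ t convex_J])
    show "((\<lambda>t. x * g (r * x) t) has_real_derivative x * Dt J g (r * x) t) (at t within J)"
      if "t \<in> J" "r \<in> cbox 0 1" for t r
      using that x by (auto intro!: DERIV_cmult has_derivative_Dt[OF g] scaled_mem_S)
    show "(\<lambda>r. x * g (r * x) t) integrable_on cbox 0 1" if "t \<in> J" for t
      using that x by (intro integrable_continuous continuous_intros cont_scaled[OF g]) auto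
    show "continuous_on (J \<times> cbox 0 1) (\<lambda>(t, r). x * Dt J g (r * x) t)"
      using x by (auto simp: split_beta intro!: continuous_intros cont_scaled[OF smooth2_Dt[OF g]])
  qed
  then show "((\<lambda>s. prim g x s) has_real_derivative prim (Dt J g) x t) (at t within J)"
    by (simp add: prim_def)
qed

text \<open>The antiderivatives of smooth functions form a closed class up to smooth functions: the space
  derivative is the smooth integrand, and the time derivative is again an antiderivative.\<close>
lemma smooth2_prim:
  assumes "smooth2 S J g"
  shows "smooth2 S J (prim g)"
proof (rule smooth2_coinduct[where X = "\<lambda>f. \<exists>g. smooth2 S J g \<and> f = prim g"])
  show "\<exists>g'. smooth2 S J g' \<and> prim g = prim g'" using assms by blast
qed (use partials_prim smooth2_Dt in blast)

lemma prim_eqI: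
  assumes g: "smooth2 S J g" and t: "t \<in> J" and x: "x \<in> S"
    and F: "\<And>y. y \<in> S \<Longrightarrow> (F has_real_derivative g y t) (at y within S)"
  shows "prim g x t = F x - F 0"
proof -
  have "\<exists>c. \<forall>y\<in>S. prim g y t - F y = c"
  proof (rule has_field_derivative_zero_constant[OF convex_S])
    show "((\<lambda>y. prim g y t - F y) has_real_derivative 0) (at y within S)" if "y \<in> S" for y
      using DERIV_diff[OF partialsD(2)[OF partials_prim[OF g] that t] F[OF that]] by simp
  qed
  then have "prim g x t - F x = prim g 0 t - F 0" using x zero_S by auto
  then show ?thesis by (simp add: prim_0)
qed

lemma prim_cong:
  assumes "x \<in> S" "\<And>y. y \<in> S \<Longrightarrow> g y t = h y t"
  shows "prim g x t = prim h x t"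
  unfolding prim_def by (rule integral_cong) (use assms scaled_mem_S in auto)

end

section \<open>Spatial domains, lifespans and periodicity\<close>

lemma space_dom_props:
  shows "convex (space_dom bc)" "{0..1} \<subseteq> space_dom bc" "x \<in> space_dom bc \<Longrightarrow> x islimpt space_dom bc"
  by (cases bc; auto simp: space_dom_def islimpt_Icc islimpt_UNIV)+

lemma lifespan_props:
  assumes "lifespan J"
  shows "convex J" "0 \<in> J" "J \<subseteq> {0..}" "t \<in> J \<Longrightarrow> t islimpt J" "t \<in> J \<Longrightarrow> {0..t} \<subseteq> J"
proof -
  consider "J = {0..}" | T where "T > 0" "J = {0..<T}" using assms unfolding lifespan_def by blast
  note cases = this
  show c: "convex J" and z: "0 \<in> J" and "J \<subseteq> {0..}" and "t \<in> J \<Longrightarrow> {0..t} \<subseteq> J"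
    using cases by (cases; force)+
  have "\<nexists>a. J = {a}"
  proof
    assume "\<exists>a. J = {a}"
    then have J: "J = {0}" using z by auto
    show False using cases
    proof cases
      case 1
      have "1 \<in> J" unfolding 1 by simp
      then show ?thesis using J by simp
    next
      case 2
      have "T / 2 \<in> J" unfolding 2(2) using 2(1) by simp
      then show ?thesis using J 2(1) by simp
    qed
  qed
  then show "t \<in> J \<Longrightarrow> t islimpt J"
    using connected_imp_perfect[OF convex_connected[OF c]] by blast
qed

lemma region_space_dom: "lifespan J \<Longrightarrow> region (space_dom bc) J"
  using space_dom_props(1,3) space_dom_props(2)[of bc] lifespan_props(1,4)
  by unfold_locales auto

lemma lifespan_atLeast: "lifespan {0..}"
  by (simp add: lifespan_def)

lemma on_circle_derivative:
  assumes "on_circle Periodic f"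
  shows "(f has_real_derivative d) (at (x + 1)) \<longleftrightarrow> (f has_real_derivative d) (at x)"
  using assms unfolding DERIV_shift on_circle_def by simp

lemma on_circle_deriv_on:
  assumes "on_circle Periodic f"
  shows "on_circle Periodic (deriv_on UNIV f)"
  using on_circle_derivative[OF assms]
  unfolding on_circle_def deriv_on_def vector_derivative_def
  by (simp add: has_real_derivative_iff_has_vector_derivative)

lemma on_circle_boundary_cond:
  assumes "on_circle Periodic f"
  shows "boundary_cond Periodic f"
  using assms on_circle_deriv_on[OF assms]
  by (force simp: boundary_cond_def on_circle_def space_dom_def dest: spec[of _ 0])

lemma on_circle_int:
  assumes "on_circle Periodic f"
  shows "f (x + of_int n) = f x"
proof (induction n rule: int_induct[of _ 0])
  case base
  then show ?case by simp
next
  case (step1 i)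
  then show ?case using assms unfolding on_circle_def by (metis add.assoc of_int_add of_int_1)
next
  case (step2 i)
  then show ?case using assms unfolding on_circle_def
    by (metis (no_types, opaque_lifting) add_diff_eq diff_add_cancel of_int_diff of_int_1)
qed

lemma circle_representative:
  fixes x :: real
  obtains n :: int where "x + of_int n \<in> {0..1}"
  by (rule that[of "- \<lfloor>x\<rfloor>"]) (auto simp: floor_correct less_imp_le, linarith)

text \<open>Reduces statements about the whole spatial domain to the unit interval, where the equations
  are imposed and compactness is available. Under the Dirichlet condition \<open>y = x\<close> does.\<close>
lemma on_circle_frac:
  assumes "x \<in> space_dom bc"
  obtains y where "y \<in> {0..1}" "\<And>f. on_circle bc f \<Longrightarrow> f x = f y"
proof (cases bc)
  case Dirichlet
  then show ?thesis using assms that[of x] by (simp add: space_dom_def)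
next
  case Periodic
  obtain n :: int where "x + of_int n \<in> {0..1}" using circle_representative by blast
  then show ?thesis using that Periodic on_circle_int by metis
qed

lemma on_circle_deriv_on_dom:
  assumes "on_circle bc f"
  shows "on_circle bc (deriv_on (space_dom bc) f)"
  using assms on_circle_deriv_on[of f] by (cases bc) (auto simp: on_circle_def space_dom_def)

lemma bounded_on_space_dom:
  assumes "compact T" "continuous_on ({0..1} \<times> T) (\<lambda>(x, t). f x t)"
    and "\<And>t. t \<in> T \<Longrightarrow> on_circle bc (\<lambda>x. f x t)"
  obtains L where "L \<ge> 0" "\<And>x t. x \<in> space_dom bc \<Longrightarrow> t \<in> T \<Longrightarrow> \<bar>f x t\<bar> \<le> (L::real)"
proof -
  have "compact ((\<lambda>(x, t). f x t) ` ({0..1} \<times> T))"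
    using assms(1,2) by (intro compact_continuous_image compact_Times) auto
  then have "bounded ((\<lambda>(x, t). f x t) ` ({0..1} \<times> T))" by (rule compact_imp_bounded)
  then obtain L where "L > 0" and L: "\<And>z. z \<in> (\<lambda>(x, t). f x t) ` ({0..1} \<times> T) \<Longrightarrow> norm z \<le> L"
    unfolding bounded_pos by blast
  have "\<bar>f x t\<bar> \<le> L" if x: "x \<in> space_dom bc" and t: "t \<in> T" for x t
  proof -
    obtain y where y: "y \<in> {0..1}" "\<And>f. on_circle bc f \<Longrightarrow> f x = f y" using on_circle_frac[OF x] by metis
    have "norm (f y t) \<le> L" using y(1) t by (intro L) (auto intro!: image_eqI[of _ _ "(y, t)"])
    then show ?thesis using y(2)[OF assms(3)[OF t]] by simp
  qed
  then show ?thesis using \<open>L > 0\<close> that[of L] by auto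
qed

section \<open>The initial velocity gradient and its exponential means\<close>

locale initial =
  fixes bc :: bdry and u0 b0 :: "real \<Rightarrow> real"
  assumes init: "initial_data bc u0 b0"
begin

abbreviation S where "S \<equiv> space_dom bc"

definition v where "v = deriv_on S u0"

text \<open>The normalising integral of the Jacobian; \<open>dM\<close> is its time derivative.\<close>
definition M where "M t = integral {0..1} (\<lambda>a. exp (t * v a))"

definition dM where "dM t = integral {0..1} (\<lambda>a. v a * exp (t * v a))"

lemma circle_u0: "on_circle bc u0" and circle_b0: "on_circle bc b0"
  and smooth_u0: "smooth1 S u0" and smooth_b0: "smooth1 S b0"
  and boundary_u0: "boundary_cond bc u0" and boundary_b0: "boundary_cond bc b0"
  using init unfolding initial_data_def by auto

lemma S_props: "0 \<in> S" "1 \<in> S" "{0..1} \<subseteq> S"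
  using space_dom_props(2)[of bc] by auto

lemma
  shows v_deriv: "x \<in> S \<Longrightarrow> (u0 has_real_derivative v x) (at x within S)"
    and smooth2_v: "smooth2 S J (\<lambda>x t. v x)"
proof -
  from smooth_u0 obtain f where f: "\<forall>x\<in>S. (u0 has_real_derivative f x) (at x within S)" "smooth1 S f"
    by (cases rule: smooth1.cases) blast
  have eq: "v x = f x" if "x \<in> S" for x
    unfolding v_def using f(1) that space_dom_props(3) by (intro deriv_on_eq) auto
  show "(u0 has_real_derivative v x) (at x within S)" if "x \<in> S" using f(1) eq that by simp
  show "smooth2 S J (\<lambda>x t. v x)" using smooth2_space[OF f(2)] by (rule smooth2_cong) (simp add: eq)
qed

lemma continuous_v: "continuous_on S v"
proof -
  have "continuous_on S (\<lambda>x. (\<lambda>(x, t). v x) (x, 0::real))"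
    by (rule continuous_on_compose2[OF continuous_on_smooth2[OF smooth2_v[of UNIV]]])
       (auto intro!: continuous_intros)
  then show ?thesis by simp
qed

lemma continuous_v01: "T \<subseteq> {0..1} \<Longrightarrow> continuous_on T v"
  using continuous_v S_props(3) continuous_on_subset by blast

lemma circle_v: "on_circle bc v"
  unfolding v_def by (rule on_circle_deriv_on_dom[OF circle_u0])

lemma bounded_v: obtains B where "B \<ge> 0" "\<And>x. x \<in> S \<Longrightarrow> \<bar>v x\<bar> \<le> B"
proof -
  have "continuous_on ({0..1} \<times> {0::real}) (\<lambda>(x, t). v x)"
    unfolding split_beta
    by (rule continuous_on_compose2[OF continuous_v]) (use S_props(3) in \<open>auto intro!: continuous_intros\<close>)
  from bounded_on_space_dom[OF compact_sing this circle_v]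
  obtain B where "B \<ge> 0" "\<And>x t. x \<in> S \<Longrightarrow> t \<in> {0::real} \<Longrightarrow> \<bar>v x\<bar> \<le> B" by metis
  then show ?thesis using that[of B] by blast
qed

lemma u0_ends: "u0 1 = u0 0"
  using boundary_u0 by (auto simp: boundary_cond_def split: bdry.splits)

text \<open>The boundary condition enters all bounds on \<open>M\<close> through this mean value.\<close>
lemma has_integral_v: "(v has_integral 0) {0..1}"
proof -
  have "(v has_integral u0 1 - u0 0) {0..1}"
    using DERIV_subset[OF v_deriv S_props(3)] S_props(3)
    by (intro fundamental_theorem_of_calculus)
       (auto simp: has_real_derivative_iff_has_vector_derivative[symmetric])
  then show ?thesis by (simp add: u0_ends)
qed

lemma exp_v_integrable: "(\<lambda>a. exp (t * v a)) integrable_on {0..1}"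
  and v_exp_v_integrable: "(\<lambda>a. v a * exp (t * v a)) integrable_on {0..1}"
  by (auto intro!: integrable_continuous_interval continuous_intros continuous_v01)

lemma M_deriv: "(M has_real_derivative dM t) (at t)"
proof -
  have c: "continuous_on (UNIV \<times> {0..1}) (\<lambda>z. v (snd z))"
    by (rule continuous_on_compose2[OF continuous_v01[OF order_refl]]) (auto intro!: continuous_intros)
  have "((\<lambda>t. integral (cbox 0 1) (\<lambda>a. exp (t * v a))) has_real_derivative
     integral (cbox 0 1) (\<lambda>a. v a * exp (t * v a))) (at t within UNIV)"
    by (rule leibniz_rule_field_derivative)
       (auto intro!: derivative_eq_intros exp_v_integrable continuous_intros continuous_v01 c
          simp: split_beta)
  then show ?thesis by (simp add: M_def[abs_def] dM_def)
qed

text \<open>This is \<open>exp y \<ge> 1 + y\<close> integrated: the linear term has mean zero.\<close>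
lemma M_ge_1: "1 \<le> M t"
proof -
  have "((\<lambda>a. 1 + t * v a) has_integral 1 + t * 0) {0..1}"
    using has_integral_const_real[of 1 0 1] by (intro has_integral_add has_integral_mult_right has_integral_v) auto
  moreover have "((\<lambda>a. exp (t * v a)) has_integral M t) {0..1}"
    unfolding M_def by (rule integrable_integral[OF exp_v_integrable])
  ultimately show ?thesis
    using has_integral_le[of "\<lambda>a. 1 + t * v a" "1 + t * 0" "{0..1}"] exp_ge_add_one_self by auto
qed

text \<open>For \<open>t \<ge> 0\<close> the weight \<open>exp(t v)\<close> is at least 1 where \<open>v \<ge> 0\<close> and at most 1 where \<open>v < 0\<close>, so
  \<open>v exp(t v) \<ge> v\<close> pointwise, and \<open>v\<close> has mean zero.\<close>
lemma dM_nonneg: assumes "0 \<le> t" shows "0 \<le> dM t"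
proof -
  have "((\<lambda>a. v a * exp (t * v a)) has_integral dM t) {0..1}"
    unfolding dM_def by (rule integrable_integral[OF v_exp_v_integrable])
  moreover have "v a \<le> v a * exp (t * v a)" for a
  proof (cases "v a \<ge> 0")
    case True
    then show ?thesis using assms mult_left_mono[of 1 "exp (t * v a)" "v a"] by simp
  next
    case False
    then have "exp (t * v a) \<le> 1" using assms by (simp add: mult_nonneg_nonpos)
    then show ?thesis using False mult_left_mono_neg[of "exp (t * v a)" 1 "v a"] by simp
  qed
  ultimately show ?thesis using has_integral_le[OF has_integral_v] by blast
qed

lemma M_0: "M 0 = 1" and dM_0: "dM 0 = 0"
  using has_integral_v by (auto simp: M_def dM_def)

end

section \<open>Every solution has the stated Jacobian and gradient\<close>

locale solution_with_flow = initial +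
  fixes J and u b p \<gamma> :: "real \<Rightarrow> real \<Rightarrow> real"
  assumes life: "lifespan J" and sol: "solution 0 0 bc J u0 b0 u b p" and lag: "lagrangian bc J u \<gamma>"
begin

sublocale region S J by (rule region_space_dom[OF life])

lemma smooth_u: "smooth2 S J u" and smooth_b: "smooth2 S J b"
  using sol by (auto simp: solution_def Let_def)

lemma initial_values: "x \<in> S \<Longrightarrow> u x 0 = u0 x" "x \<in> S \<Longrightarrow> b x 0 = b0 x"
  using sol by (auto simp: solution_def Let_def)

lemma circle: "t \<in> J \<Longrightarrow> on_circle bc (\<lambda>x. u x t)" "t \<in> J \<Longrightarrow> on_circle bc (\<lambda>x. b x t)"
  and boundary_u: "t \<in> J \<Longrightarrow> boundary_cond bc (\<lambda>x. u x t)"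
  using sol by (auto simp: solution_def Let_def)

lemma circle_Dx:
  assumes "on_circle bc (\<lambda>x. f x t)" shows "on_circle bc (\<lambda>x. Dx S f x t)"
  using on_circle_deriv_on_dom[OF assms] unfolding Dx_def[abs_def] by (simp add: on_circle_def)

lemma circle_Dt:
  assumes f: "smooth2 S J f" and c: "\<And>t. t \<in> J \<Longrightarrow> on_circle bc (\<lambda>x. f x t)" and t: "t \<in> J"
  shows "on_circle bc (\<lambda>x. Dt J f x t)"
  unfolding on_circle_def
proof (intro impI allI)
  fix x assume bc: "bc = Periodic"
  then have x: "x \<in> S" by (simp add: space_dom_def)
  show "Dt J f (x + 1) t = Dt J f x t"
    by (rule Dt_eq[OF t], rule has_field_derivative_transform_within[OF has_derivative_Dt[OF f x t], of 1])
       (use t c bc in \<open>auto simp: on_circle_def\<close>)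
qed

text \<open>Periodic trajectories leave the unit interval, so the equations have to be carried over to the
  whole spatial domain before they can be used along a trajectory.\<close>
lemma velocity_gradient_equation:
  assumes "x \<in> S" "t \<in> J"
  shows "Dx S (Dx S u) x t * u x t + Dt J (Dx S u) x t = nonlocal_term 0 0 S u b t"
proof -
  obtain y where y: "y \<in> {0..1}" "\<And>f. on_circle bc f \<Longrightarrow> f x = f y" using on_circle_frac[OF assms(1)] by metis
  have "Dt J (Dx S u) y t + u y t * Dx S (Dx S u) y t = nonlocal_term 0 0 S u b t"
    using sol y(1) assms(2) by (auto simp: solution_def Let_def)
  moreover have "Dt J (Dx S u) x t = Dt J (Dx S u) y t"
    using y(2)[OF circle_Dt[OF smooth2_Dx[OF smooth_u] circle_Dx[of u, OF circle(1)] assms(2)]] .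
  moreover have "Dx S (Dx S u) x t = Dx S (Dx S u) y t"
    using y(2)[OF circle_Dx[of "Dx S u" t, OF circle_Dx[of u, OF circle(1)[OF assms(2)]]]] .
  moreover have "u x t = u y t" using y(2)[OF circle(1)[OF assms(2)]] .
  ultimately show ?thesis by (simp add: mult.commute)
qed

lemma transport_equation:
  assumes "x \<in> S" "t \<in> J"
  shows "Dx S b x t * u x t + Dt J b x t = 0"
proof -
  obtain y where y: "y \<in> {0..1}" "\<And>f. on_circle bc f \<Longrightarrow> f x = f y" using on_circle_frac[OF assms(1)] by metis
  have "Dt J b y t + u y t * Dx S b y t = 0"
    using sol y(1) assms(2) by (auto simp: solution_def Let_def)
  moreover have "Dt J b x t = Dt J b y t" using y(2)[OF circle_Dt[OF smooth_b circle(2) assms(2)]] .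
  moreover have "Dx S b x t = Dx S b y t" using y(2)[OF circle_Dx[of b, OF circle(2)[OF assms(2)]]] .
  moreover have "u x t = u y t" using y(2)[OF circle(1)[OF assms(2)]] .
  ultimately show ?thesis by (simp add: mult.commute)
qed

lemma zero_J: "0 \<in> J" and J_nonneg: "t \<in> J \<Longrightarrow> 0 \<le> t" and upto_J: "t \<in> J \<Longrightarrow> {0..t} \<subseteq> J"
  using lifespan_props[OF life] by auto

lemma flow:
  assumes "a \<in> {0..1}"
  shows flow_0: "\<gamma> a 0 = a" and flow_S: "t \<in> J \<Longrightarrow> \<gamma> a t \<in> S"
    and flow_deriv: "t \<in> J \<Longrightarrow> (\<gamma> a has_real_derivative u (\<gamma> a t) t) (at t within J)"
  using lag assms unfolding lagrangian_def by auto

lemma constant_on_J: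
  assumes "\<And>t. t \<in> J \<Longrightarrow> (f has_real_derivative 0) (at t within J)" "t \<in> J"
  shows "f t = f 0"
  using has_field_derivative_zero_constant[OF convex_J, of f] assms zero_J by metis

lemma b_along_flow:
  assumes a: "a \<in> {0..1}" and t: "t \<in> J"
  shows "b (\<gamma> a t) t = b0 a"
proof -
  have "b (\<gamma> a t) t = b (\<gamma> a 0) 0"
    using has_derivative_along_curve[OF smooth_b _ flow_S[OF a] flow_deriv[OF a]]
      transport_equation[OF flow_S[OF a]] t by (intro constant_on_J) auto
  then show ?thesis using flow_0[OF a] initial_values(2) a S_props(3) by auto
qed

text \<open>Minus the time integral of the nonlocal term, read off from the trajectory that starts at 0:
  in this form continuity is immediate.\<close>
definition K where "K t = v 0 - Dx S u (\<gamma> 0 t) t"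

lemma u_x_deriv_along_flow:
  assumes "a \<in> {0..1}" "t \<in> J"
  shows "((\<lambda>s. Dx S u (\<gamma> a s) s) has_real_derivative nonlocal_term 0 0 S u b t) (at t within J)"
  using has_derivative_along_curve[OF smooth2_Dx[OF smooth_u] assms(2) flow_S[OF assms(1)] flow_deriv[OF assms]]
    velocity_gradient_equation[OF flow_S[OF assms] assms(2)] by simp

lemma u_x_initial: "x \<in> S \<Longrightarrow> Dx S u x 0 = v x"
  by (rule Dx_eq, simp, rule has_field_derivative_transform_within[OF v_deriv, of _ 1])
     (auto simp: initial_values)

text \<open>The rate of change of \<open>u\<^sub>x\<close> along a trajectory is the same for all labels, so the difference
  between two trajectories stays what it was initially.\<close>
lemma u_x_along_flow:
  assumes a: "a \<in> {0..1}" and t: "t \<in> J"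
  shows "Dx S u (\<gamma> a t) t = v a - K t"
proof -
  let ?f = "\<lambda>t. Dx S u (\<gamma> a t) t - Dx S u (\<gamma> 0 t) t"
  have "?f t = ?f 0"
    using u_x_deriv_along_flow[OF a] u_x_deriv_along_flow[of 0] t
    by (intro constant_on_J) (auto intro!: derivative_eq_intros)
  moreover have "?f 0 = v a - v 0"
    using a S_props(3) flow_0[OF a] flow_0[of 0] u_x_initial by (auto simp: subset_iff)
  ultimately show ?thesis by (simp add: K_def)
qed

lemma K_0: "K 0 = 0"
  using flow_0[of 0] u_x_initial S_props by (simp add: K_def)

lemma continuous_K: "continuous_on J K"
  unfolding K_def
  by (intro continuous_intros DERIV_continuous_on[OF u_x_deriv_along_flow]) auto

definition intK where "intK s = integral {0..s} K"

context
  fixes T assumes T: "T \<in> J"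
begin

lemma upto_T: "s \<in> {0..T} \<Longrightarrow> s \<in> J"
  using upto_J[OF T] by auto

lemma bounded_u_x:
  obtains L where "L \<ge> 0" "\<And>x s. x \<in> S \<Longrightarrow> s \<in> {0..T} \<Longrightarrow> \<bar>Dx S u x s\<bar> \<le> L"
proof -
  have cont: "continuous_on ({0..1} \<times> {0..T}) (\<lambda>(x, t). Dx S u x t)"
    by (rule continuous_on_subset[OF continuous_on_smooth2[OF smooth2_Dx[OF smooth_u]]])
       (use S_props(3) upto_J[OF T] in auto)
  show ?thesis
    by (rule bounded_on_space_dom[OF compact_Icc cont circle_Dx[of u, OF circle(1)[OF upto_T]]])
       (assumption, rule that)
qed

lemma u_mvt:
  assumes "x \<in> S" "y \<in> S" "s \<in> J"
  obtains c where "c \<in> closed_segment x y" "c \<in> S" "u y s - u x s = Dx S u c s * (y - x)"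
  using mvt_segment[OF convex_S assms(1,2) has_derivative_Dx[OF smooth_u _ assms(3)]] .

text \<open>General solutions of the trajectory equation up to time \<open>T\<close>. Besides \<open>\<gamma> a\<close> they include the
  resting end points and the shifted curve \<open>\<gamma> 1 - 1\<close>, with which the flow is compared to find its total
  length.\<close>
definition trajectory where
  "trajectory y \<longleftrightarrow> (\<forall>s\<in>{0..T}. y s \<in> S \<and> (y has_real_derivative u (y s) s) (at s within {0..T}))"

lemma trajectory_flow: "a \<in> {0..1} \<Longrightarrow> trajectory (\<gamma> a)"
  unfolding trajectory_def
  by (intro ballI conjI flow_S DERIV_subset[OF flow_deriv upto_J[OF T]] upto_T)

text \<open>With \<open>d = y - z\<close>, the mean value theorem bounds \<open>\<bar>d d'\<bar>\<close> by \<open>L d\<^sup>2\<close>, so \<open>(d exp(-L s))\<^sup>2\<close> is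
  nonincreasing and \<open>(d exp(L s))\<^sup>2\<close> nondecreasing. The lower bound keeps distinct trajectories apart.\<close>
lemma trajectories_distance:
  assumes y: "trajectory y" and z: "trajectory z" and s: "s \<in> {0..T}"
    and L: "\<And>x s. x \<in> S \<Longrightarrow> s \<in> {0..T} \<Longrightarrow> \<bar>Dx S u x s\<bar> \<le> L"
  shows "\<bar>y s - z s\<bar> \<le> \<bar>y 0 - z 0\<bar> * exp (L * s)" "\<bar>y 0 - z 0\<bar> \<le> \<bar>y s - z s\<bar> * exp (L * s)"
proof -
  \<comment> \<open>The sign \<open>\<sigma> = 1\<close> gives the upper bound and \<open>\<sigma> = -1\<close> the lower one, both by monotonicity.\<close>
  have deriv: "((\<lambda>r. - (\<sigma> * ((y r - z r) * exp (\<sigma> * (- L) * r))\<^sup>2)) has_real_derivative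
      2 * (exp (\<sigma> * (- L) * r))\<^sup>2 * (L * \<sigma>\<^sup>2 * (y r - z r)\<^sup>2 - \<sigma> * ((y r - z r) * (u (y r) r - u (z r) r)))) (at r within {0..s})"
    if "r \<in> {0..s}" for r \<sigma>
  proof -
    have "(y has_real_derivative u (y r) r) (at r within {0..s})" "(z has_real_derivative u (z r) r) (at r within {0..s})"
      using y z that s unfolding trajectory_def
      by (auto intro: DERIV_subset[where s = "{0..T}" and t = "{0..s}"])
    then show ?thesis
      by (auto intro!: derivative_eq_intros simp: algebra_simps power2_eq_square)
  qed
  have growth: "\<bar>(y r - z r) * (u (y r) r - u (z r) r)\<bar> \<le> L * (y r - z r)\<^sup>2" if "r \<in> {0..s}" for r
  proof -
    have r: "r \<in> {0..T}" using that s by auto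
    then have "y r \<in> S" "z r \<in> S" using y z by (auto simp: trajectory_def)
    then obtain c where c: "c \<in> S" "u (y r) r - u (z r) r = Dx S u c r * (y r - z r)"
      using u_mvt[OF _ _ upto_T[OF r]] by metis
    have "\<bar>(y r - z r) * (u (y r) r - u (z r) r)\<bar> = \<bar>Dx S u c r\<bar> * (y r - z r)\<^sup>2"
      by (simp add: c(2) abs_mult power2_eq_square)
    also have "\<dots> \<le> L * (y r - z r)\<^sup>2" using L[OF c(1) r] by (intro mult_right_mono) auto
    finally show ?thesis .
  qed
  have mono: "- (\<sigma> * ((y 0 - z 0) * exp (\<sigma> * (- L) * 0))\<^sup>2) \<le> - (\<sigma> * ((y s - z s) * exp (\<sigma> * (- L) * s))\<^sup>2)"
    if "\<sigma> \<in> {1, -1}" for \<sigma>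
  proof (rule mono_from_derivative[OF _ deriv])
    fix r assume "r \<in> {0..s}"
    from growth[OF this] that
    show "0 \<le> 2 * (exp (\<sigma> * (- L) * r))\<^sup>2 * (L * \<sigma>\<^sup>2 * (y r - z r)\<^sup>2 - \<sigma> * ((y r - z r) * (u (y r) r - u (z r) r)))"
      by (intro mult_nonneg_nonneg) auto
  qed (use s in auto)
  have "\<bar>(y s - z s) * exp (- L * s)\<bar> \<le> \<bar>y 0 - z 0\<bar>"
    using mono[of 1] by (simp add: abs_le_square_iff)
  then show "\<bar>y s - z s\<bar> \<le> \<bar>y 0 - z 0\<bar> * exp (L * s)"
    by (simp add: abs_mult exp_minus field_simps)
  have "\<bar>y 0 - z 0\<bar> \<le> \<bar>(y s - z s) * exp (L * s)\<bar>"
    using mono[of "-1"] by (simp add: abs_le_square_iff)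
  then show "\<bar>y 0 - z 0\<bar> \<le> \<bar>y s - z s\<bar> * exp (L * s)"
    by (simp add: abs_mult)
qed

lemma trajectories_equal:
  assumes "trajectory y" "trajectory z" "y 0 = z 0" "s \<in> {0..T}"
  shows "y s = z s"
proof -
  obtain L where L: "\<And>x s. x \<in> S \<Longrightarrow> s \<in> {0..T} \<Longrightarrow> \<bar>Dx S u x s\<bar> \<le> L" using bounded_u_x by metis
  show ?thesis using trajectories_distance(1)[OF assms(1,2,4) L] assms(3) by simp
qed

lemma flow_continuous:
  assumes "s \<in> {0..T}"
  shows "continuous_on {0..1} (\<lambda>a. \<gamma> a s)"
proof -
  obtain L where L: "\<And>x s. x \<in> S \<Longrightarrow> s \<in> {0..T} \<Longrightarrow> \<bar>Dx S u x s\<bar> \<le> L" using bounded_u_x by metis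
  have "(exp (L * s))-lipschitz_on {0..1} (\<lambda>a. \<gamma> a s)"
  proof (rule lipschitz_onI)
    fix a c :: real assume ac: "a \<in> {0..1}" "c \<in> {0..1}"
    show "dist (\<gamma> a s) (\<gamma> c s) \<le> exp (L * s) * dist a c"
      using trajectories_distance(1)[OF trajectory_flow[OF ac(1)] trajectory_flow[OF ac(2)] assms L] flow_0 ac
      by (simp add: dist_real_def mult.commute)
  qed simp
  then show ?thesis by (rule lipschitz_on_continuous_on)
qed

text \<open>The gap between two trajectories starts positive and never vanishes.\<close>
lemma flow_less:
  assumes ac: "a \<in> {0..1}" "c \<in> {0..1}" "a < c" and s: "s \<in> {0..T}"
  shows "\<gamma> a s < \<gamma> c s"
proof (rule ccontr)
  assume *: "\<not> \<gamma> a s < \<gamma> c s"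
  obtain L where L: "\<And>x s. x \<in> S \<Longrightarrow> s \<in> {0..T} \<Longrightarrow> \<bar>Dx S u x s\<bar> \<le> L" using bounded_u_x by metis
  have ne: "\<gamma> c r - \<gamma> a r \<noteq> 0" if "r \<in> {0..T}" for r
    using trajectories_distance(2)[OF trajectory_flow[OF ac(2)] trajectory_flow[OF ac(1)] that L] flow_0 ac by auto
  have "continuous_on {0..T} (\<lambda>r. \<gamma> c r - \<gamma> a r)"
    using ac by (intro continuous_intros DERIV_continuous_on[OF flow_deriv[THEN DERIV_subset[OF _ upto_J[OF T]]]])
      (use upto_T in auto)
  then have "continuous_on {0..s} (\<lambda>r. \<gamma> c r - \<gamma> a r)"
    by (rule continuous_on_subset) (use s in auto)
  then obtain r where "0 \<le> r" "r \<le> s" "\<gamma> c r - \<gamma> a r = 0"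
    using IVT2'[of "\<lambda>r. \<gamma> c r - \<gamma> a r" s 0 0] * s ac flow_0 by auto
  then show False using ne[of r] s by auto
qed

text \<open>The intermediate point of the mean value theorem for \<open>u\<close> lies between two trajectories, and by
  continuity of the flow in the label it is itself on a trajectory, with a label \<open>e\<close> in between.\<close>
lemma flow_u_difference:
  assumes ac: "a \<in> {0..1}" "c \<in> {0..1}" "a < c" and s: "s \<in> {0..T}"
  obtains e where "e \<in> {a..c}" "u (\<gamma> c s) s - u (\<gamma> a s) s = (v e - K s) * (\<gamma> c s - \<gamma> a s)"
proof -
  obtain x where x: "x \<in> closed_segment (\<gamma> a s) (\<gamma> c s)"
    "u (\<gamma> c s) s - u (\<gamma> a s) s = Dx S u x s * (\<gamma> c s - \<gamma> a s)"
    using u_mvt[OF flow_S[OF ac(1)] flow_S[OF ac(2)]] upto_T[OF s] by metis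
  have "continuous_on {a..c} (\<lambda>a. \<gamma> a s)"
    by (rule continuous_on_subset[OF flow_continuous[OF s]]) (use ac in auto)
  then obtain e where e: "e \<in> {a..c}" "\<gamma> e s = x"
    using IVT'[of "\<lambda>a. \<gamma> a s" a x c] x(1) ac(3) flow_less[OF ac s]
    by (auto simp: closed_segment_eq_real_ivl)
  then show ?thesis using that[of e] x(2) u_x_along_flow[of e s] ac upto_T[OF s] by auto
qed

lemma intK_deriv: "s \<in> {0..T} \<Longrightarrow> (intK has_real_derivative K s) (at s within {0..T})"
  unfolding intK_def[abs_def]
  by (rule integral_has_real_derivative[OF continuous_on_subset[OF continuous_K upto_J[OF T]]])

text \<open>The gap \<open>d\<close> satisfies \<open>d' = (v e - K) d\<close> with a time-dependent label \<open>e\<close>. Hence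
  \<open>d exp(\<integral>K - m s)\<close> is monotone in \<open>s\<close> as soon as \<open>m\<close> bounds \<open>v\<close> from one side on \<open>[a,c]\<close>.\<close>
lemma flow_difference_growth:
  assumes ac: "a \<in> {0..1}" "c \<in> {0..1}" "a < c"
  shows "(\<And>e. e \<in> {a..c} \<Longrightarrow> m \<le> v e) \<Longrightarrow> (c - a) * exp (T * m) \<le> (\<gamma> c T - \<gamma> a T) * exp (intK T)"
    and "(\<And>e. e \<in> {a..c} \<Longrightarrow> v e \<le> m) \<Longrightarrow> (\<gamma> c T - \<gamma> a T) * exp (intK T) \<le> (c - a) * exp (T * m)"
proof -
  let ?h = "\<lambda>s. (\<gamma> c s - \<gamma> a s) * exp (intK s - m * s)"
  let ?h' = "\<lambda>s. (u (\<gamma> c s) s - u (\<gamma> a s) s + (K s - m) * (\<gamma> c s - \<gamma> a s)) * exp (intK s - m * s)"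
  have T0: "0 \<le> T" using J_nonneg[OF T] .
  have h': "(?h has_real_derivative ?h' s) (at s within {0..T})" if s: "s \<in> {0..T}" for s
  proof -
    have "(\<gamma> c has_real_derivative u (\<gamma> c s) s) (at s within {0..T})"
      "(\<gamma> a has_real_derivative u (\<gamma> a s) s) (at s within {0..T})"
      using trajectory_flow ac s unfolding trajectory_def by auto
    then show ?thesis using intK_deriv[OF s]
      by (auto intro!: derivative_eq_intros simp: algebra_simps)
  qed
  have rate: "\<exists>e\<in>{a..c}. ?h' s = (v e - m) * ((\<gamma> c s - \<gamma> a s) * exp (intK s - m * s))"
    if s: "s \<in> {0..T}" for s
  proof -
    obtain e where e: "e \<in> {a..c}" and
      diff: "u (\<gamma> c s) s - u (\<gamma> a s) s = (v e - K s) * (\<gamma> c s - \<gamma> a s)"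
      using flow_u_difference[OF ac s] .
    have "?h' s = (v e - m) * ((\<gamma> c s - \<gamma> a s) * exp (intK s - m * s))"
      unfolding diff by (simp add: algebra_simps)
    then show ?thesis using e by blast
  qed
  have pos: "0 \<le> (\<gamma> c s - \<gamma> a s) * exp (intK s - m * s)" if "s \<in> {0..T}" for s
    using flow_less[OF ac that] by simp
  have h0: "?h 0 = c - a" using flow_0 ac by (simp add: intK_def)
  have hT: "?h T = (\<gamma> c T - \<gamma> a T) * exp (intK T) / exp (T * m)" by (simp add: exp_diff mult.commute)
  show "(c - a) * exp (T * m) \<le> (\<gamma> c T - \<gamma> a T) * exp (intK T)" if m: "\<And>e. e \<in> {a..c} \<Longrightarrow> m \<le> v e"
  proof -
    have "?h 0 \<le> ?h T"
    proof (rule mono_from_derivative[OF T0 h'])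
      fix s assume s: "s \<in> {0..T}"
      then obtain e where "e \<in> {a..c}" "?h' s = (v e - m) * ((\<gamma> c s - \<gamma> a s) * exp (intK s - m * s))"
        using rate by blast
      then show "0 \<le> ?h' s" using mult_nonneg_nonneg[OF _ pos[OF s], of "v e - m"] m[of e] by simp
    qed
    then show ?thesis unfolding h0 hT by (simp add: field_simps)
  qed
  show "(\<gamma> c T - \<gamma> a T) * exp (intK T) \<le> (c - a) * exp (T * m)" if m: "\<And>e. e \<in> {a..c} \<Longrightarrow> v e \<le> m"
  proof -
    have "- ?h 0 \<le> - ?h T"
    proof (rule mono_from_derivative[OF T0 DERIV_minus[OF h']])
      fix s assume s: "s \<in> {0..T}"
      then obtain e where "e \<in> {a..c}" "?h' s = (v e - m) * ((\<gamma> c s - \<gamma> a s) * exp (intK s - m * s))"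
        using rate by blast
      then show "0 \<le> - ?h' s" using mult_nonpos_nonneg[OF _ pos[OF s], of "v e - m"] m[of e] by simp
    qed
    then show ?thesis unfolding h0 hT by (simp add: field_simps)
  qed
qed

text \<open>Taking for \<open>m\<close> the extreme values of \<open>v\<close> on \<open>[a,c]\<close> traps the rescaled difference quotient
  between two values of \<open>exp(T v)\<close>, so it is attained at some label.\<close>
lemma flow_secant:
  assumes ac: "a \<in> {0..1}" "c \<in> {0..1}" "a < c"
  obtains e where "e \<in> {a..c}" "\<gamma> c T - \<gamma> a T = (c - a) * exp (T * v e - intK T)"
proof -
  have cont: "continuous_on {a..c} v" using ac by (intro continuous_v01) auto
  obtain e1 where e1: "e1 \<in> {a..c}" "\<And>e. e \<in> {a..c} \<Longrightarrow> v e1 \<le> v e"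
    using continuous_attains_inf[OF _ _ cont] ac by auto
  obtain e2 where e2: "e2 \<in> {a..c}" "\<And>e. e \<in> {a..c} \<Longrightarrow> v e \<le> v e2"
    using continuous_attains_sup[OF _ _ cont] ac by auto
  let ?q = "(\<gamma> c T - \<gamma> a T) * exp (intK T) / (c - a)"
  have "exp (T * v e1) \<le> ?q" "?q \<le> exp (T * v e2)"
    using flow_difference_growth(1)[OF ac e1(2)] flow_difference_growth(2)[OF ac e2(2)] ac(3)
    by (auto simp: field_simps)
  moreover have "connected ((\<lambda>e. exp (T * v e)) ` {a..c})"
    by (intro connected_continuous_image continuous_intros cont) simp
  ultimately have "?q \<in> (\<lambda>e. exp (T * v e)) ` {a..c}"
    using connected_contains_Icc[of "(\<lambda>e. exp (T * v e)) ` {a..c}" "exp (T * v e1)" "exp (T * v e2)",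
        OF _ imageI[OF e1(1)] imageI[OF e2(1)]] by fastforce
  then obtain e where "e \<in> {a..c}" "?q = exp (T * v e)" by auto
  then show ?thesis using ac(3) by (intro that[of e]) (auto simp: exp_diff field_simps)
qed

lemma flow_deriv_space:
  assumes a: "a \<in> {0..1}"
  shows "((\<lambda>a. \<gamma> a T) has_real_derivative exp (T * v a - intK T)) (at a within {0..1})"
proof (rule derivative_from_secants[OF a])
  show "((\<lambda>a. exp (T * v a - intK T)) \<longlongrightarrow> exp (T * v a - intK T)) (at a within {0..1})"
    using continuous_v01[OF order_refl] a by (intro tendsto_intros) (auto simp: continuous_on_def)
  fix c :: real assume c: "c \<in> {0..1}"
  consider "a = c" | "a < c" | "c < a" by linarith
  then show "\<exists>e\<in>closed_segment a c. e \<in> {0..1} \<and> \<gamma> c T - \<gamma> a T = (c - a) * exp (T * v e - intK T)"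
  proof cases
    case 1
    then show ?thesis using a by auto
  next
    case 2
    obtain e where "e \<in> {a..c}" "\<gamma> c T - \<gamma> a T = (c - a) * exp (T * v e - intK T)" using flow_secant[OF a c 2] .
    then show ?thesis using a c 2 by (intro bexI[of _ e]) (auto simp: closed_segment_eq_real_ivl)
  next
    case 3
    obtain e where "e \<in> {c..a}" "\<gamma> a T - \<gamma> c T = (a - c) * exp (T * v e - intK T)" using flow_secant[OF c a 3] .
    then show ?thesis using a c 3 by (intro bexI[of _ e]) (auto simp: closed_segment_eq_real_ivl algebra_simps)
  qed
qed

text \<open>Under the Dirichlet condition the end points are at rest. Under the periodic one, \<open>\<gamma> 1 - 1\<close>
  and \<open>\<gamma> 0\<close> solve the same initial value problem.\<close>
lemma flow_total_length: "\<gamma> 1 T - \<gamma> 0 T = 1"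
proof (cases bc)
  case Dirichlet
  have "trajectory (\<lambda>s. c)" if "c \<in> {0, 1}" for c
    using that Dirichlet boundary_u upto_T S_props
    unfolding trajectory_def by (auto simp: boundary_cond_def)
  then have "\<gamma> 1 T = 1" "\<gamma> 0 T = 0"
    using trajectories_equal[OF trajectory_flow[of 1], of "\<lambda>s. 1" T]
      trajectories_equal[OF trajectory_flow[of 0], of "\<lambda>s. 0" T] flow_0 J_nonneg[OF T] by auto
  then show ?thesis by simp
next
  case Periodic
  have "u (\<gamma> 1 s - 1) s = u (\<gamma> 1 s) s" if "s \<in> {0..T}" for s
    using circle(1)[OF upto_T[OF that]] Periodic unfolding on_circle_def by (metis diff_add_cancel)
  then have "trajectory (\<lambda>s. \<gamma> 1 s - 1)"
    using trajectory_flow[of 1] Periodic unfolding trajectory_def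
    by (auto simp: space_dom_def intro!: derivative_eq_intros)
  then have "\<gamma> 1 T - 1 = \<gamma> 0 T"
    using trajectories_equal[OF _ trajectory_flow[of 0], of "\<lambda>s. \<gamma> 1 s - 1" T] flow_0 J_nonneg[OF T] by auto
  then show ?thesis by simp
qed

text \<open>Integrate the Jacobian over all labels.\<close>
lemma exp_intK: "exp (intK T) = M T"
proof -
  have "((\<lambda>a. exp (T * v a - intK T)) has_integral \<gamma> 1 T - \<gamma> 0 T) {0..1}"
    by (rule fundamental_theorem_of_calculus)
       (use flow_deriv_space in \<open>auto simp: has_real_derivative_iff_has_vector_derivative[symmetric]\<close>)
  then have "((\<lambda>a. exp (T * v a - intK T) * exp (intK T)) has_integral 1 * exp (intK T)) {0..1}"
    unfolding flow_total_length by (rule has_integral_mult_left)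
  then show ?thesis
    by (simp add: exp_diff M_def integral_unique)
qed

end

text \<open>Differentiate \<open>exp(\<integral>\<^sub>0\<^sup>t K) = M(t)\<close> from the left at \<open>t\<close>. At time 0 there is no left side, and
  both sides vanish.\<close>
lemma K_eq:
  assumes t: "t \<in> J" shows "K t = dM t / M t"
proof (cases "t = 0")
  case True
  then show ?thesis by (simp add: K_0 dM_0)
next
  case False
  then have t0: "t > 0" using J_nonneg[OF t] by simp
  have "((\<lambda>s. exp (intK s)) has_real_derivative exp (intK t) * K t) (at t within {0..t})"
    using intK_deriv[OF t, of t] t0 by (auto intro!: derivative_eq_intros)
  then have "(M has_real_derivative exp (intK t) * K t) (at t within {0..t})"
    by (rule has_field_derivative_transform_within[of _ _ _ _ 1])
       (use t0 exp_intK upto_J[OF t] in auto)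
  moreover have "(M has_real_derivative dM t) (at t within {0..t})"
    using M_deriv by (rule has_field_derivative_at_within)
  moreover have "t islimpt {0..t}" using t0 by (simp add: islimpt_Icc)
  ultimately have "exp (intK t) * K t = dM t"
    using deriv_on_eq[of t "{0..t}" M] by metis
  then show ?thesis using exp_intK[OF t] M_ge_1[of t] by (auto simp: field_simps)
qed

lemma K_bounds: "t \<in> J \<Longrightarrow> 0 \<le> K t" "t \<in> J \<Longrightarrow> K t \<le> dM t"
proof -
  assume t: "t \<in> J"
  have M: "0 < M t" using M_ge_1[of t] by simp
  show K: "0 \<le> K t" using K_eq[OF t] dM_nonneg[OF J_nonneg[OF t]] M by simp
  have "K t * 1 \<le> K t * M t" using M_ge_1[of t] K by (rule mult_left_mono)
  then show "K t \<le> dM t" using K_eq[OF t] M by simp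
qed

lemma jacobian:
  assumes "a \<in> {0..1}" "t \<in> J"
  shows "((\<lambda>a. \<gamma> a t) has_real_derivative exp (t * v a) * inverse (M t)) (at a within {0..1})"
  using flow_deriv_space[OF assms(2,1)] exp_intK[OF assms(2)] by (simp add: exp_diff divide_inverse)

end

section \<open>Construction of a global solution from its flow\<close>

locale construction = initial
begin

abbreviation J :: "real set" where "J \<equiv> {0..}"

sublocale region S J by (rule region_space_dom[OF lifespan_atLeast])

definition e_tv where "e_tv a t = exp (t * v a)"
definition v_e_tv where "v_e_tv a t = v a * exp (t * v a)"

text \<open>The flow map, then its velocity, its Jacobian and its velocity gradient as functions of the
  label. The term \<open>u0 0 * t\<close> moves the particle with label 0 at constant speed, a choice that the periodic
  problem leaves open; the value at time 0 is dictated by the initial velocity, and under the Dirichlet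
  condition the term is zero.\<close>
definition Phi where "Phi a t = u0 0 * t + prim e_tv a t / M t"
definition Phi_t where "Phi_t a t = u0 0 + (prim v_e_tv a t * M t - prim e_tv a t * dM t) / (M t * M t)"
definition Phi_a where "Phi_a a t = e_tv a t / M t"
definition grad where "grad a t = v a - dM t / M t"

lemma M_pos: "0 < M t" "M t \<noteq> 0"
  using M_ge_1[of t] by auto

lemma smooth2_e_tv: "smooth2 S J e_tv" and smooth2_v_e_tv: "smooth2 S J v_e_tv"
  unfolding e_tv_def[abs_def] v_e_tv_def[abs_def] by (intro smooth2_intros smooth2_v)+

lemma prim_e_tv_1: "prim e_tv 1 t = M t" and prim_v_e_tv_1: "prim v_e_tv 1 t = dM t"
  by (simp_all add: prim_1 M_def dM_def e_tv_def v_e_tv_def)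

lemma smooth2_M: "smooth2 S J (\<lambda>x. M)" and smooth2_dM: "smooth2 S J (\<lambda>x. dM)"
  using smooth2_slice[OF smooth2_prim[OF smooth2_e_tv] S_props(2)]
    smooth2_slice[OF smooth2_prim[OF smooth2_v_e_tv] S_props(2)]
  by (simp_all add: prim_e_tv_1 prim_v_e_tv_1)

lemma smooth2_Phi: "smooth2 S J Phi" and smooth2_Phi_t: "smooth2 S J Phi_t"
  and smooth2_Phi_a: "smooth2 S J Phi_a" and smooth2_grad: "smooth2 S J grad"
  unfolding Phi_def[abs_def] Phi_t_def[abs_def] Phi_a_def[abs_def] grad_def[abs_def]
  by (intro smooth2_intros smooth2_divide smooth2_v smooth2_M smooth2_dM smooth2_e_tv
      smooth2_prim smooth2_v_e_tv no_zero_divisors M_pos(2))+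

lemma prim_e_tv_deriv:
  assumes "x \<in> S" "t \<in> J"
  shows "((\<lambda>y. prim e_tv y t) has_real_derivative e_tv x t) (at x within S)"
    "((\<lambda>s. prim e_tv x s) has_real_derivative prim v_e_tv x t) (at t within J)"
    "((\<lambda>y. prim v_e_tv y t) has_real_derivative v_e_tv x t) (at x within S)"
proof -
  have "Dt J e_tv y t = v_e_tv y t" for y
    using assms(2) by (intro Dt_eq) (auto simp: e_tv_def v_e_tv_def intro!: derivative_eq_intros)
  then have "prim (Dt J e_tv) x t = prim v_e_tv x t" using assms(1) by (intro prim_cong) auto
  then show "((\<lambda>s. prim e_tv x s) has_real_derivative prim v_e_tv x t) (at t within J)"
    using partialsD(3)[OF partials_prim[OF smooth2_e_tv] assms] by simp
  show "((\<lambda>y. prim e_tv y t) has_real_derivative e_tv x t) (at x within S)"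
    "((\<lambda>y. prim v_e_tv y t) has_real_derivative v_e_tv x t) (at x within S)"
    using partialsD(2)[OF partials_prim[OF smooth2_e_tv] assms]
      partialsD(2)[OF partials_prim[OF smooth2_v_e_tv] assms] by auto
qed

lemma Phi_deriv:
  assumes "x \<in> S" "t \<in> J"
  shows "((\<lambda>y. Phi y t) has_real_derivative Phi_a x t) (at x within S)"
    and "((\<lambda>s. Phi x s) has_real_derivative Phi_t x t) (at t within J)"
  using prim_e_tv_deriv[OF assms] M_deriv[of t, THEN has_field_derivative_at_within] M_pos(2)[of t]
  unfolding Phi_def Phi_t_def Phi_a_def
  by (auto intro!: derivative_eq_intros simp: field_simps)

lemma Dx_Phi_t:
  assumes "x \<in> S" "t \<in> J"
  shows "Dx S Phi_t x t = Phi_a x t * grad x t"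
  using prim_e_tv_deriv[OF assms] M_pos(2)[of t] assms
  unfolding Phi_t_def[abs_def] Phi_a_def grad_def
  by (intro Dx_eq) (auto intro!: derivative_eq_intros simp: field_simps e_tv_def v_e_tv_def)

text \<open>The dependence on the label and on time is additive in \<^const>\<open>grad\<close>.\<close>
lemma Dt_grad:
  assumes "x \<in> S" "t \<in> J"
  shows "Dt J grad x t = Dt J grad 0 t"
proof (rule Dt_eq[OF assms(2)])
  have "((\<lambda>s. v x - v 0 + grad 0 s) has_real_derivative 0 + Dt J grad 0 t) (at t within J)"
    by (intro DERIV_add DERIV_const has_derivative_Dt[OF smooth2_grad zero_S assms(2)])
  then show "(grad x has_real_derivative Dt J grad 0 t) (at t within J)" by (simp add: grad_def[abs_def])
qed

lemma Phi_a_pos: "0 < Phi_a x t"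
  by (simp add: Phi_a_def e_tv_def M_pos)

lemma Phi_mvt:
  assumes "x \<in> S" "y \<in> S" "t \<in> J"
  obtains c where "c \<in> closed_segment x y" "c \<in> S" "Phi y t - Phi x t = Phi_a c t * (y - x)"
  using mvt_segment[OF convex_S assms(1,2) Phi_deriv(1)[OF _ assms(3)]] .

lemma Phi_mono:
  assumes "x \<in> S" "y \<in> S" "t \<in> J" "x \<le> y"
  shows "Phi x t \<le> Phi y t"
proof -
  obtain c where "Phi y t - Phi x t = Phi_a c t * (y - x)" using Phi_mvt[OF assms(1-3)] .
  then show ?thesis using Phi_a_pos[of c t] assms(4)
    by (metis diff_ge_0_iff_ge less_imp_le mult_nonneg_nonneg)
qed

text \<open>As \<open>\<bar>v\<bar> \<le> B\<close>, the Jacobian is at least \<open>exp(-2 B t)\<close>: one factor \<open>exp(-B t)\<close> comes from the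
  exponential and the other from \<open>M(t) \<le> exp(B t)\<close>. This one estimate gives injectivity, surjectivity on
  the line, and continuity of the inverse.\<close>
lemma Phi_expansion:
  obtains B where "\<And>x y t. x \<in> S \<Longrightarrow> y \<in> S \<Longrightarrow> t \<in> J \<Longrightarrow> \<bar>y - x\<bar> \<le> exp (B * t) * \<bar>Phi y t - Phi x t\<bar>"
proof -
  obtain B where B: "B \<ge> 0" "\<And>x. x \<in> S \<Longrightarrow> \<bar>v x\<bar> \<le> B" using bounded_v by metis
  have Phi_a: "1 \<le> exp (2 * B * t) * Phi_a x t" if x: "x \<in> S" and t: "t \<in> J" for x t
  proof -
    have "((\<lambda>a. exp (t * v a)) has_integral M t) {0..1}"
      unfolding M_def by (rule integrable_integral[OF exp_v_integrable])
    moreover have "((\<lambda>a::real. exp (t * B)) has_integral exp (t * B)) {0..1}"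
      using has_integral_const_real[of "exp (t * B)" 0 1] by simp
    moreover have "exp (t * v a) \<le> exp (t * B)" if "a \<in> {0..1}" for a
      using B(2)[of a] that S_props(3) t by (auto intro!: mult_left_mono)
    ultimately have "M t \<le> exp (t * B)" by (rule has_integral_le)
    moreover have "exp (- (t * B)) \<le> e_tv x t"
      using mult_left_mono[of "- B" "v x" t] B(2)[OF x] t unfolding e_tv_def by auto
    ultimately have "M t \<le> exp (2 * B * t) * e_tv x t"
      using mult_left_mono[of "exp (- (t * B))" "e_tv x t" "exp (2 * B * t)"]
      by (simp add: exp_add[symmetric] algebra_simps)
    then show ?thesis using M_pos[of t] by (simp add: Phi_a_def field_simps)
  qed
  show ?thesis
  proof (rule that[of "2 * B"])
    fix x y t assume *: "x \<in> S" "y \<in> S" "t \<in> J"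
    obtain c where c: "c \<in> S" "Phi y t - Phi x t = Phi_a c t * (y - x)" using Phi_mvt[OF *] by metis
    have "\<bar>y - x\<bar> * 1 \<le> \<bar>y - x\<bar> * (exp (2 * B * t) * Phi_a c t)"
      by (rule mult_left_mono[OF Phi_a[OF c(1) *(3)]]) simp
    then show "\<bar>y - x\<bar> \<le> exp (2 * B * t) * \<bar>Phi y t - Phi x t\<bar>"
      unfolding c(2) using Phi_a_pos[of c t] by (simp add: abs_mult mult_ac)
  qed
qed

lemma Phi_continuous: "t \<in> J \<Longrightarrow> T \<subseteq> S \<Longrightarrow> continuous_on T (\<lambda>a. Phi a t)"
  by (rule continuous_on_subset[OF DERIV_continuous_on[OF Phi_deriv(1)]])

lemma Phi_ends: "Phi 0 t = u0 0 * t" "Phi 1 t = u0 0 * t + 1"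
  using M_pos by (simp_all add: Phi_def prim_0 prim_e_tv_1)

lemma u0_Dirichlet: "bc = Dirichlet \<Longrightarrow> u0 0 = 0"
  using boundary_u0 by (simp add: boundary_cond_def)

lemma Phi_in_S:
  assumes "a \<in> S" "t \<in> J"
  shows "Phi a t \<in> S"
proof (cases bc)
  case Dirichlet
  then have "a \<in> {0..1}" using assms by (simp add: space_dom_def)
  then show ?thesis
    using Phi_mono[OF S_props(1) assms] Phi_mono[OF assms(1) S_props(2) assms(2)] Phi_ends[of t]
      u0_Dirichlet[OF Dirichlet] Dirichlet by (simp add: space_dom_def)
qed (simp add: space_dom_def)

lemma Phi_inj:
  assumes "x \<in> S" "y \<in> S" "t \<in> J" "Phi x t = Phi y t"
  shows "x = y"
proof -
  obtain B where "\<And>x y t. x \<in> S \<Longrightarrow> y \<in> S \<Longrightarrow> t \<in> J \<Longrightarrow> \<bar>y - x\<bar> \<le> exp (B * t) * \<bar>Phi y t - Phi x t\<bar>"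
    using Phi_expansion by metis
  from this[OF assms(1-3)] show ?thesis using assms(4) by simp
qed

text \<open>On the unit interval the end points are fixed. On the line, expansion pushes the labels \<open>\<plusminus>N\<close> past
  \<open>x\<close> on either side.\<close>
lemma Phi_surj:
  assumes x: "x \<in> S" and t: "t \<in> J"
  shows "\<exists>a\<in>S. Phi a t = x"
proof (cases bc)
  case Dirichlet
  then have "0 \<le> x" "x \<le> 1" using x by (auto simp: space_dom_def)
  then obtain a where "0 \<le> a" "a \<le> 1" "Phi a t = x"
    using IVT'[of "\<lambda>a. Phi a t" 0 x 1] Phi_ends[of t] u0_Dirichlet[OF Dirichlet]
      Phi_continuous[OF t S_props(3)] by auto
  then show ?thesis using S_props(3) by auto
next
  case Periodic
  then have S: "S = UNIV" by (simp add: space_dom_def)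
  obtain B where "\<And>x y t. x \<in> S \<Longrightarrow> y \<in> S \<Longrightarrow> t \<in> J \<Longrightarrow> \<bar>y - x\<bar> \<le> exp (B * t) * \<bar>Phi y t - Phi x t\<bar>"
    using Phi_expansion by metis
  then have B: "\<bar>y\<bar> \<le> exp (B * t) * \<bar>Phi y t - Phi 0 t\<bar>" for y
    using t S by (metis UNIV_I diff_zero)
  define N where "N = exp (B * t) * \<bar>x - Phi 0 t\<bar>"
  have N: "0 \<le> N" by (simp add: N_def)
  have far: "\<bar>x - Phi 0 t\<bar> \<le> \<bar>Phi y t - Phi 0 t\<bar>" if "\<bar>y\<bar> = N" for y
    using B[of y] unfolding that N_def by simp
  have "Phi (- N) t \<le> Phi 0 t" "Phi 0 t \<le> Phi N t"
    using Phi_mono[of "- N" 0 t] Phi_mono[of 0 N t] N t S by auto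
  then have "Phi (- N) t \<le> x" "x \<le> Phi N t"
    using far[of N] far[of "- N"] N by auto
  then obtain a where "Phi a t = x"
    using IVT'[of "\<lambda>a. Phi a t" "- N" x N] Phi_continuous[OF t] N S by auto
  then show ?thesis using S by auto
qed

definition label where "label x t = (SOME a. a \<in> S \<and> Phi a t = x)"

lemma label:
  assumes "x \<in> S" "t \<in> J"
  shows label_S: "label x t \<in> S" and Phi_label: "Phi (label x t) t = x"
  using someI_ex[of "\<lambda>a. a \<in> S \<and> Phi a t = x"] Phi_surj[OF assms] unfolding label_def by blast+

lemma label_eqI: "a \<in> S \<Longrightarrow> t \<in> J \<Longrightarrow> Phi a t = x \<Longrightarrow> label x t = a"
  using Phi_inj label Phi_in_S by metis

text \<open>By the expansion estimate at the current time, the change of label is at most a locally bounded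
  multiple of the distance from \<open>x\<close> to the present position of the old label, which tends to 0.\<close>
lemma label_continuous: "continuous_on (S \<times> J) (\<lambda>z. label (fst z) (snd z))"
  unfolding continuous_on_def
proof
  fix z0 assume z0: "z0 \<in> S \<times> J"
  define a where "a = label (fst z0) (snd z0)"
  have a: "a \<in> S" "Phi a (snd z0) = fst z0" using label z0 unfolding a_def by auto
  obtain B where B: "\<And>x y t. x \<in> S \<Longrightarrow> y \<in> S \<Longrightarrow> t \<in> J \<Longrightarrow> \<bar>y - x\<bar> \<le> exp (B * t) * \<bar>Phi y t - Phi x t\<bar>"
    using Phi_expansion by metis
  have "continuous_on (S \<times> J) (\<lambda>z. (\<lambda>(x, t). Phi x t) (a, snd z))"
    by (rule continuous_on_compose2[OF continuous_on_smooth2[OF smooth2_Phi]])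
       (use a in \<open>auto intro!: continuous_intros\<close>)
  then have "continuous_on (S \<times> J) (\<lambda>z. exp (B * snd z) * \<bar>fst z - Phi a (snd z)\<bar>)"
    by (auto intro!: continuous_intros)
  then have "((\<lambda>z. exp (B * snd z) * \<bar>fst z - Phi a (snd z)\<bar>) \<longlongrightarrow> exp (B * snd z0) * \<bar>fst z0 - Phi a (snd z0)\<bar>)
      (at z0 within S \<times> J)"
    using z0 unfolding continuous_on_def by blast
  then have lim: "((\<lambda>z. exp (B * snd z) * \<bar>fst z - Phi a (snd z)\<bar>) \<longlongrightarrow> 0) (at z0 within S \<times> J)"
    by (simp add: a)
  have "\<forall>\<^sub>F z in at z0 within S \<times> J. z \<in> S \<times> J" by (simp add: eventually_at_filter)
  then have "\<forall>\<^sub>F z in at z0 within S \<times> J.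
      norm (label (fst z) (snd z) - a) \<le> exp (B * snd z) * \<bar>fst z - Phi a (snd z)\<bar>"
  proof (rule eventually_mono)
    fix z assume "z \<in> S \<times> J"
    then have z: "fst z \<in> S" "snd z \<in> J" by auto
    show "norm (label (fst z) (snd z) - a) \<le> exp (B * snd z) * \<bar>fst z - Phi a (snd z)\<bar>"
      using B[OF a(1) label_S[OF z] z(2)] Phi_label[OF z] by simp
  qed
  from LIM_zero_cancel[OF Lim_null_comparison[OF this lim]]
  show "((\<lambda>z. label (fst z) (snd z)) \<longlongrightarrow> label (fst z0) (snd z0)) (at z0 within S \<times> J)"
    by (simp add: a_def)
qed

lemma continuous_on_label_compose:
  assumes "smooth2 S J h" "continuous_on T x" "continuous_on T t" "\<And>z. z \<in> T \<Longrightarrow> x z \<in> S \<and> t z \<in> J"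
  shows "continuous_on T (\<lambda>z. h (label (x z) (t z)) (t z))"
proof -
  have e: "continuous_on T (\<lambda>z. label (x z) (t z))"
    using continuous_on_compose2[OF label_continuous, of T "\<lambda>z. (x z, t z)"] assms(2-4)
    by (auto intro!: continuous_intros)
  show ?thesis
    using continuous_on_compose2[OF continuous_on_smooth2[OF assms(1)], of T "\<lambda>z. (label (x z) (t z), t z)"]
      e assms(2-4) label_S by (force intro!: continuous_intros)
qed

text \<open>The mean value theorem for the flow, read backwards, is a secant formula for its inverse.\<close>
lemma label_deriv_space:
  assumes x: "x \<in> S" and t: "t \<in> J"
  shows "((\<lambda>y. label y t) has_real_derivative inverse (Phi_a (label x t) t)) (at x within S)"
proof (rule derivative_from_secants[OF x, of "\<lambda>x. inverse (Phi_a (label x t) t)"])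
  have "continuous_on S (\<lambda>y. inverse (Phi_a (label y t) t))"
    using Phi_a_pos t by (intro continuous_intros continuous_on_label_compose[OF smooth2_Phi_a]) (auto simp: less_imp_neq[symmetric])
  then show "((\<lambda>y. inverse (Phi_a (label y t) t)) \<longlongrightarrow> inverse (Phi_a (label x t) t)) (at x within S)"
    using x unfolding continuous_on_def by blast
  fix y assume y: "y \<in> S"
  obtain c where c: "c \<in> closed_segment (label x t) (label y t)" "c \<in> S"
    "Phi (label y t) t - Phi (label x t) t = Phi_a c t * (label y t - label x t)"
    using Phi_mvt[OF label_S[OF x t] label_S[OF y t] t] .
  have "Phi c t \<in> closed_segment x y"
    using c(1) Phi_mono[OF c(2) label_S[OF x t] t] Phi_mono[OF c(2) label_S[OF y t] t]
      Phi_mono[OF label_S[OF x t] c(2) t] Phi_mono[OF label_S[OF y t] c(2) t]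
    unfolding Phi_label[OF x t] Phi_label[OF y t]
    by (auto simp: closed_segment_eq_real_ivl split: if_splits)
  moreover have "label (Phi c t) t = c" using label_eqI[OF c(2) t refl] .
  moreover have "label y t - label x t = (y - x) * inverse (Phi_a c t)"
    using c(3) Phi_a_pos[of c t] unfolding Phi_label[OF x t] Phi_label[OF y t] by (simp add: field_simps)
  ultimately show "\<exists>c\<in>closed_segment x y. c \<in> S \<and> label y t - label x t = (y - x) * inverse (Phi_a (label c t) t)"
    using Phi_in_S[OF c(2) t] by (intro bexI[of _ "Phi c t"]) auto
qed

text \<open>The position is constant: the change of label at fixed time compensates the displacement of
  the old label. The first is \<open>\<Phi>\<^sub>a\<close> at an intermediate label times the change of label, and the second
  is \<open>\<Phi>\<^sub>t\<close> to first order.\<close>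
lemma label_deriv_time:
  assumes x: "x \<in> S" and t: "t \<in> J"
  shows "((\<lambda>s. label x s) has_real_derivative - (Phi_t (label x t) t / Phi_a (label x t) t)) (at t within J)"
proof -
  define a where "a = label x t"
  have a: "a \<in> S" "Phi a t = x" using label[OF x t] by (auto simp: a_def)
  have "\<exists>c. c \<in> closed_segment a (label x s) \<and> c \<in> S \<and> Phi (label x s) s - Phi a s = Phi_a c s * (label x s - a)"
    if "s \<in> J" for s using Phi_mvt[OF a(1) label_S[OF x that] that] by metis
  then obtain c where c: "\<forall>s\<in>J. c s \<in> closed_segment a (label x s) \<and> c s \<in> S \<and>
      Phi (label x s) s - Phi a s = Phi_a (c s) s * (label x s - a)" by metis
  have ev: "\<forall>\<^sub>F s in at t within J. s \<in> J \<and> s \<noteq> t" by (auto simp: eventually_at_filter)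
  have "continuous_on J (\<lambda>s. (x, s))" by (intro continuous_intros)
  from continuous_on_compose2[OF label_continuous this]
  have "continuous_on J (\<lambda>s. label x s)" using x by auto
  then have "((\<lambda>s. label x s) \<longlongrightarrow> a) (at t within J)"
    using t unfolding continuous_on_def a_def by blast
  then have lim_c: "(c \<longlongrightarrow> a) (at t within J)"
    by (rule filterlim_closed_segment) (rule eventually_mono[OF ev], use c in blast)
  have "continuous (at (a, t) within S \<times> J) (\<lambda>(x, t). Phi_a x t)"
    using continuous_on_smooth2[OF smooth2_Phi_a] a t by (auto simp: continuous_on_eq_continuous_within)
  moreover have "\<forall>\<^sub>F s in at t within J. (c s, s) \<in> S \<times> J"
    using ev by (rule eventually_mono) (use c in blast)
  ultimately have "((\<lambda>s. (\<lambda>(x, t). Phi_a x t) (c s, s)) \<longlongrightarrow> (\<lambda>(x, t). Phi_a x t) (a, t)) (at t within J)"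
    by (rule continuous_within_tendsto_compose) (intro tendsto_Pair lim_c tendsto_ident_at)
  then have lim_Phi_a: "((\<lambda>s. Phi_a (c s) s) \<longlongrightarrow> Phi_a a t) (at t within J)" by simp
  have "((\<lambda>s. (Phi a s - Phi a t) / (s - t)) \<longlongrightarrow> Phi_t a t) (at t within J)"
    using Phi_deriv(2)[OF a(1) t] unfolding has_field_derivative_iff .
  from tendsto_minus[OF tendsto_divide[OF this lim_Phi_a]]
  have "((\<lambda>s. - ((Phi a s - Phi a t) / (s - t) / Phi_a (c s) s)) \<longlongrightarrow> - (Phi_t a t / Phi_a a t)) (at t within J)"
    using Phi_a_pos[of a t] by simp
  moreover have "\<forall>\<^sub>F s in at t within J. - ((Phi a s - Phi a t) / (s - t) / Phi_a (c s) s) = (label x s - label x t) / (s - t)"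
    using ev
  proof (rule eventually_mono)
    fix s assume s: "s \<in> J \<and> s \<noteq> t"
    then have "x - Phi a s = Phi_a (c s) s * (label x s - a)" using c Phi_label[OF x] by auto
    then have "- (Phi a s - Phi a t) = Phi_a (c s) s * (label x s - label x t)" using a by (simp add: a_def)
    then have "- ((Phi a s - Phi a t) / Phi_a (c s) s) = label x s - label x t"
      using Phi_a_pos[of "c s" s] by (simp add: field_simps)
    then show "- ((Phi a s - Phi a t) / (s - t) / Phi_a (c s) s) = (label x s - label x t) / (s - t)"
      by (metis divide_divide_eq_left divide_divide_eq_left' minus_divide_left)
  qed
  ultimately show ?thesis unfolding has_field_derivative_iff a_def[symmetric]
    by (rule Lim_transform_eventually)
qed

definition eulerian :: "(real \<Rightarrow> real \<Rightarrow> real) \<Rightarrow> real \<Rightarrow> real \<Rightarrow> real" where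
  "eulerian h x t = h (label x t) t"

lemma partials_eulerian:
  assumes h: "smooth2 S J h"
  shows "partials S J (eulerian h) (eulerian (\<lambda>a t. Dx S h a t / Phi_a a t))
    (eulerian (\<lambda>a t. Dt J h a t - Dx S h a t * Phi_t a t / Phi_a a t))"
  unfolding partials_def
proof (intro conjI ballI)
  show "continuous_on (S \<times> J) (\<lambda>(x, t). eulerian h x t)"
    unfolding eulerian_def split_beta
    by (rule continuous_on_label_compose[OF h]) (auto intro!: continuous_intros)
  fix x t assume x: "x \<in> S" and t: "t \<in> J"
  show "((\<lambda>y. eulerian h y t) has_real_derivative eulerian (\<lambda>a t. Dx S h a t / Phi_a a t) x t) (at x within S)"
    using field_derivative_compose_within[OF has_derivative_Dx[OF h label_S[OF x t] t] label_deriv_space[OF x t]] label_S t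
    by (auto simp: eulerian_def divide_inverse)
  show "((\<lambda>s. eulerian h x s) has_real_derivative eulerian (\<lambda>a t. Dt J h a t - Dx S h a t * Phi_t a t / Phi_a a t) x t) (at t within J)"
    using has_derivative_along_curve[OF h t label_S[OF x] label_deriv_time[OF x t]]
    by (simp add: eulerian_def algebra_simps)
qed

text \<open>Since \<open>\<Phi>\<^sub>a\<close> and \<open>\<Phi>\<^sub>t\<close> are smooth functions of the label, both partial derivatives of
  \<open>h(label(x,t),t)\<close> are again smooth functions of the label, evaluated at \<open>label(x,t)\<close>.\<close>
lemma smooth2_eulerian:
  assumes "smooth2 S J h" shows "smooth2 S J (eulerian h)"
proof (rule smooth2_coinduct[where X = "\<lambda>f. \<exists>h. smooth2 S J h \<and> f = eulerian h"])
  show "\<exists>h'. smooth2 S J h' \<and> eulerian h = eulerian h'" using assms by blast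
next
  fix f assume "\<exists>h. smooth2 S J h \<and> f = eulerian h"
  then obtain h where h: "smooth2 S J h" and f: "f = eulerian h" by blast
  have nz: "Phi_a a t \<noteq> 0" for a t using Phi_a_pos[of a t] by simp
  have "smooth2 S J (\<lambda>a t. Dx S h a t / Phi_a a t)"
    by (rule smooth2_divide[OF smooth2_Dx[OF h] smooth2_Phi_a nz])
  moreover have "smooth2 S J (\<lambda>a t. Dt J h a t - Dx S h a t * Phi_t a t / Phi_a a t)"
    by (rule smooth2_diff[OF smooth2_Dt[OF h] smooth2_divide[OF smooth2_mult[OF smooth2_Dx[OF h] smooth2_Phi_t] smooth2_Phi_a nz]])
  ultimately show "\<exists>fx ft. partials S J f fx ft \<and>
      ((\<exists>h. smooth2 S J h \<and> fx = eulerian h) \<or> smooth2 S J fx) \<and>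
      ((\<exists>h. smooth2 S J h \<and> ft = eulerian h) \<or> smooth2 S J ft)"
    using partials_eulerian[OF h] f by blast
qed

definition u where "u = eulerian Phi_t"
definition b where "b = eulerian (\<lambda>a t. b0 a)"

lemma smooth2_u: "smooth2 S J u" and smooth2_b: "smooth2 S J b"
  unfolding u_def b_def by (intro smooth2_eulerian smooth2_Phi_t smooth2_space[OF smooth_b0])+

text \<open>The Jacobian cancels in \<open>\<Phi>\<^sub>a\<^sub>t / \<Phi>\<^sub>a\<close>.\<close>
lemma Dx_u:
  assumes "x \<in> S" "t \<in> J" shows "Dx S u x t = eulerian grad x t"
  using partials_unique(1)[OF partials_eulerian[OF smooth2_Phi_t] assms] Dx_Phi_t[OF label_S[OF assms] assms(2)]
    Phi_a_pos[of "label x t" t]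
  unfolding u_def eulerian_def by simp

text \<open>The material derivative of a function of the label and time is its time derivative at fixed
  label.\<close>
lemma velocity_gradient:
  assumes "x \<in> S" "t \<in> J"
  shows "Dt J (Dx S u) x t + u x t * Dx S (Dx S u) x t = Dt J grad 0 t"
proof -
  have "partials S J (Dx S u) (eulerian (\<lambda>a t. Dx S grad a t / Phi_a a t))
    (eulerian (\<lambda>a t. Dt J grad a t - Dx S grad a t * Phi_t a t / Phi_a a t))"
    using Dx_u by (rule partials_cong[OF partials_eulerian[OF smooth2_grad]])
  from partials_unique[OF this assms] show ?thesis
    using Dt_grad[OF label_S[OF assms] assms(2)] by (simp add: eulerian_def u_def)
qed

lemma b_transport:
  assumes "x \<in> S" "t \<in> J"
  shows "Dt J b x t + u x t * Dx S b x t = 0"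
proof -
  have "Dt J (\<lambda>a t. b0 a) y t = 0" for y using assms(2) by (intro Dt_eq) auto
  then show ?thesis
    using partials_unique[OF partials_eulerian[OF smooth2_space[OF smooth_b0]] assms]
    by (simp add: eulerian_def u_def b_def)
qed

lemma prim_shift:
  assumes h: "smooth2 S J h" "\<And>t. on_circle bc (\<lambda>x. h x t)" and bc: "bc = Periodic" and t: "t \<in> J"
  shows "prim h (x + 1) t = prim h x t + prim h 1 t"
proof -
  have S: "S = UNIV" using bc by (simp add: space_dom_def)
  have "((\<lambda>x. prim h (x + 1) t) has_real_derivative h y t) (at y within S)" for y
    using partialsD(2)[OF partials_prim[OF h(1)] _ t, of "y + 1"] h(2) bc S
    by (simp add: DERIV_shift on_circle_def)
  from prim_eqI[OF h(1) t _ this, of x] S show ?thesis by simp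
qed

lemma circle_e_tv: "on_circle bc (\<lambda>x. e_tv x t)" and circle_v_e_tv: "on_circle bc (\<lambda>x. v_e_tv x t)"
  using circle_v by (simp_all add: on_circle_def e_tv_def v_e_tv_def)

lemma
  assumes bc: "bc = Periodic" and t: "t \<in> J"
  shows Phi_shift: "Phi (x + 1) t = Phi x t + 1" and Phi_t_shift: "Phi_t (x + 1) t = Phi_t x t"
proof -
  have "prim e_tv (x + 1) t = prim e_tv x t + M t" "prim v_e_tv (x + 1) t = prim v_e_tv x t + dM t"
    using prim_shift[OF smooth2_e_tv circle_e_tv bc t] prim_shift[OF smooth2_v_e_tv circle_v_e_tv bc t]
    by (simp_all add: prim_e_tv_1 prim_v_e_tv_1)
  then show "Phi (x + 1) t = Phi x t + 1" "Phi_t (x + 1) t = Phi_t x t"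
    using M_pos(2)[of t] by (simp_all add: Phi_def Phi_t_def add_divide_distrib algebra_simps)
qed

lemma circle_eulerian:
  assumes "on_circle bc (\<lambda>a. h a t)" "t \<in> J"
  shows "on_circle bc (\<lambda>x. eulerian h x t)"
  unfolding on_circle_def
proof (intro impI allI)
  fix x assume bc: "bc = Periodic"
  then have S: "S = UNIV" by (simp add: space_dom_def)
  have "label (x + 1) t = label x t + 1"
    using Phi_shift[OF bc assms(2)] Phi_label[OF _ assms(2)] S assms(2) by (intro label_eqI) auto
  moreover have "\<forall>a. h (a + 1) t = h a t" using assms(1) bc unfolding on_circle_def by blast
  ultimately show "eulerian h (x + 1) t = eulerian h x t" by (simp add: eulerian_def)
qed

lemma circle_u: "t \<in> J \<Longrightarrow> on_circle bc (\<lambda>x. u x t)"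
  unfolding u_def using Phi_t_shift by (intro circle_eulerian) (auto simp only: on_circle_def)

lemma circle_b: "t \<in> J \<Longrightarrow> on_circle bc (\<lambda>x. b x t)"
  unfolding b_def by (rule circle_eulerian) (auto simp: circle_b0)

lemma boundary:
  assumes t: "t \<in> J"
  shows "boundary_cond bc (\<lambda>x. u x t)" "boundary_cond bc (\<lambda>x. b x t)"
proof -
  have "boundary_cond bc (\<lambda>x. u x t) \<and> boundary_cond bc (\<lambda>x. b x t)"
  proof (cases bc)
    case Dirichlet
    have "label 0 t = 0" "label 1 t = 1"
      using label_eqI[OF S_props(1) t] label_eqI[OF S_props(2) t] Phi_ends[of t] u0_Dirichlet[OF Dirichlet] by simp_all
    moreover have "Phi_t 0 t = 0" "Phi_t 1 t = 0"
      using u0_Dirichlet[OF Dirichlet] by (simp_all add: Phi_t_def prim_0 prim_e_tv_1 prim_v_e_tv_1)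
    moreover have "b0 0 = 0" "b0 1 = 0" using boundary_b0 Dirichlet by (simp_all add: boundary_cond_def)
    ultimately have "boundary_cond Dirichlet (\<lambda>x. u x t) \<and> boundary_cond Dirichlet (\<lambda>x. b x t)"
      by (simp add: boundary_cond_def u_def b_def eulerian_def)
    then show ?thesis using Dirichlet by simp
  next
    case Periodic
    then show ?thesis using on_circle_boundary_cond circle_u[OF t] circle_b[OF t] by auto
  qed
  then show "boundary_cond bc (\<lambda>x. u x t)" "boundary_cond bc (\<lambda>x. b x t)" by auto
qed

lemma Phi_0: "x \<in> S \<Longrightarrow> Phi x 0 = x"
  using prim_eqI[OF smooth2_e_tv, of 0 x "\<lambda>x. x"] by (simp add: Phi_def M_0 e_tv_def)

lemma initially:
  assumes "x \<in> S" shows "u x 0 = u0 x" "b x 0 = b0 x"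
proof -
  have "label x 0 = x" using assms Phi_0 by (intro label_eqI) auto
  moreover have "prim v_e_tv x 0 = u0 x - u0 0"
    using assms v_deriv by (intro prim_eqI[OF smooth2_v_e_tv]) (auto simp: v_e_tv_def)
  ultimately show "u x 0 = u0 x" "b x 0 = b0 x"
    by (simp_all add: u_def b_def eulerian_def Phi_t_def M_0 dM_0)
qed

lemma u_ends:
  assumes "t \<in> J"
  shows "u 1 t = u 0 t" "u 1 t * Dx S u 1 t = u 0 t * Dx S u 0 t"
  using boundary(1)[OF assms] unfolding Dx_def by (auto simp: boundary_cond_def split: bdry.splits)

text \<open>The integral of \<open>u\<^sub>x\<close> is \<open>u(1,t) - u(0,t) = 0\<close> at all times, so its time derivative vanishes.\<close>
lemma integral_Dt_Dx_u:
  assumes t: "t \<in> J"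
  shows "integral {0..1} (\<lambda>x. Dt J (Dx S u) x t) = 0"
proof -
  have "prim (Dx S u) 1 s = 0" if "s \<in> J" for s
    using prim_eqI[OF smooth2_Dx[OF smooth2_u] that S_props(2) has_derivative_Dx[OF smooth2_u _ that]]
      u_ends(1)[OF that] by simp
  then have "((\<lambda>s. prim (Dx S u) 1 s) has_real_derivative 0) (at t within J)"
    using has_field_derivative_transform_within[OF DERIV_const[of 0 "at t within J"], of 1 "prim (Dx S u) 1"] t
    by simp
  then have "Dt J (prim (Dx S u)) 1 t = 0" by (rule Dt_eq[OF t])
  then show ?thesis
    using partials_unique(2)[OF partials_prim[OF smooth2_Dx[OF smooth2_u]] S_props(2) t]
    by (simp add: prim_1)
qed

text \<open>Integrate \<open>u\<^sub>x\<^sub>t + u u\<^sub>x\<^sub>x\<close>, which is constant in \<open>x\<close>, over \<open>[0,1]\<close>. The first term contributes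
  nothing, and the second contributes \<open>-\<integral>u\<^sub>x\<^sup>2\<close> by parts, since the boundary terms \<open>u u\<^sub>x\<close> cancel.\<close>
lemma Dt_grad_eq_nonlocal_term:
  assumes t: "t \<in> J"
  shows "Dt J grad 0 t = nonlocal_term 0 0 S u b t"
proof -
  let ?ux = "\<lambda>x. Dx S u x t" and ?uxx = "\<lambda>x. Dx S (Dx S u) x t" and ?uxt = "\<lambda>x. Dt J (Dx S u) x t"
  have cont: "continuous_on {0..1} (\<lambda>x. h x t)" if "smooth2 S J h" for h
  proof -
    have "continuous_on {0..1} (\<lambda>x. (x, t))" by (intro continuous_intros)
    from continuous_on_compose2[OF continuous_on_smooth2[OF that] this] show ?thesis
      using t S_props(3) by auto
  qed
  note smooth_ux = smooth2_Dx[OF smooth2_u]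
  have "((\<lambda>x. ?ux x * ?ux x + ?uxx x * u x t) has_integral u 1 t * ?ux 1 - u 0 t * ?ux 0) {0..1}"
  proof (rule fundamental_theorem_of_calculus)
    fix x :: real assume "x \<in> {0..1}"
    then have x: "x \<in> S" using S_props(3) by blast
    have "((\<lambda>x. u x t * ?ux x) has_real_derivative ?ux x * ?ux x + ?uxx x * u x t) (at x within S)"
      using has_derivative_Dx[OF smooth2_u x t] has_derivative_Dx[OF smooth_ux x t] by (rule DERIV_mult)
    then show "((\<lambda>x. u x t * ?ux x) has_vector_derivative ?ux x * ?ux x + ?uxx x * u x t) (at x within {0..1})"
      unfolding has_real_derivative_iff_has_vector_derivative[symmetric] by (rule DERIV_subset[OF _ S_props(3)])
  qed simp
  then have 1: "((\<lambda>x. ?ux x * ?ux x + ?uxx x * u x t) has_integral 0) {0..1}"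
    by (simp only: u_ends(2)[OF t] diff_self)
  have 2: "(?uxt has_integral 0) {0..1}"
    using integrable_integral[OF integrable_continuous_interval[OF cont[OF smooth2_Dt[OF smooth_ux]]]]
    unfolding integral_Dt_Dx_u[OF t] .
  have 3: "((\<lambda>x. (?ux x)\<^sup>2) has_integral integral {0..1} (\<lambda>x. (?ux x)\<^sup>2)) {0..1}"
    by (intro integrable_integral integrable_continuous_interval continuous_intros cont smooth_ux)
  have "((\<lambda>x. ?uxt x + (?ux x * ?ux x + ?uxx x * u x t) - (?ux x)\<^sup>2) has_integral
      0 + 0 - integral {0..1} (\<lambda>x. (?ux x)\<^sup>2)) {0..1}"
    by (intro has_integral_add has_integral_diff 1 2 3)
  moreover have "?uxt x + (?ux x * ?ux x + ?uxx x * u x t) - (?ux x)\<^sup>2 = Dt J grad 0 t" if "x \<in> {0..1}" for x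
    using velocity_gradient[of x t] that S_props(3) t by (auto simp: power2_eq_square mult.commute)
  ultimately have "((\<lambda>x::real. Dt J grad 0 t) has_integral 0 + 0 - integral {0..1} (\<lambda>x. (?ux x)\<^sup>2)) {0..1}"
    by (rule has_integral_eq[rotated])
  moreover have "((\<lambda>x::real. Dt J grad 0 t) has_integral Dt J grad 0 t) {0..1}"
    using has_integral_const_real[of "Dt J grad 0 t" 0 1] by simp
  ultimately have "0 + 0 - integral {0..1} (\<lambda>x. (?ux x)\<^sup>2) = Dt J grad 0 t" by (rule has_integral_unique)
  moreover have "0 \<le> integral {0..1} (\<lambda>x. (?ux x)\<^sup>2)"
    by (intro integral_nonneg has_integral_integrable[OF 3]) auto
  ultimately show ?thesis by (auto simp: nonlocal_term_def L2_norm_def)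
qed

text \<open>The momentum equation prescribes the gradient of the pressure. In the periodic problem this gradient
  may have nonzero mean, and then \<open>p\<close> grows linearly in \<open>x\<close>.\<close>
definition p where "p = prim (\<lambda>x t. b x t * Dx S b x t - Dt J u x t - u x t * Dx S u x t)"

lemma smooth2_force: "smooth2 S J (\<lambda>x t. b x t * Dx S b x t - Dt J u x t - u x t * Dx S u x t)"
  by (intro smooth2_diff smooth2_mult smooth2_b smooth2_u smooth2_Dx smooth2_Dt)

lemma solution_construction: "solution 0 0 bc J u0 b0 u b p"
  unfolding solution_def Let_def
proof (intro conjI ballI smooth2_u smooth2_b initially circle_u circle_b boundary)
  show "smooth2 S J p" unfolding p_def by (rule smooth2_prim[OF smooth2_force])
  fix x t :: real assume "x \<in> {0..1}" and t: "t \<in> J"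
  then have x: "x \<in> S" using S_props(3) by blast
  show "Dt J (Dx S u) x t + u x t * Dx S (Dx S u) x t =
      0 * (Dx S u x t)\<^sup>2 - 0 * (Dx S b x t)\<^sup>2 + 0 * b x t * Dx S (Dx S b) x t + nonlocal_term 0 0 S u b t"
    using velocity_gradient[OF x t] Dt_grad_eq_nonlocal_term[OF t] by simp
  show "Dt J b x t + u x t * Dx S b x t = 0 * b x t * Dx S u x t"
    using b_transport[OF x t] by simp
  show "Dt J u x t + u x t * Dx S u x t = - Dx S p x t + b x t * Dx S b x t"
    using partials_unique(1)[OF partials_prim[OF smooth2_force] x t] by (simp add: p_def)
qed

lemma lagrangian_construction: "lagrangian bc J u Phi"
  unfolding lagrangian_def
proof (intro ballI conjI)
  fix a :: real assume "a \<in> {0..1}"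
  then have a: "a \<in> S" using S_props(3) by blast
  show "Phi a 0 = a" using Phi_0[OF a] .
  fix t :: real assume t: "t \<in> J"
  show "Phi a t \<in> S" using Phi_in_S[OF a t] .
  show "((\<lambda>s. Phi a s) has_real_derivative u (Phi a t) t) (at t within J)"
    using Phi_deriv(2)[OF a t] label_eqI[OF a t refl] by (simp add: u_def eulerian_def)
qed

end

section \<open>Global existence and the Lagrangian formulas\<close>

theorem theorem8p1:
  fixes lam kap :: real and bc :: bdry and u\<^sub>0 b\<^sub>0 :: "real \<Rightarrow> real"
  assumes "lam = 0" and "kap = 0"
    and "initial_data bc u\<^sub>0 b\<^sub>0"
  shows "(\<exists>u b p \<gamma>. solution lam kap bc {0..} u\<^sub>0 b\<^sub>0 u b p \<and> lagrangian bc {0..} u \<gamma>) \<and>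
    (\<forall>J u b p \<gamma>. lifespan J \<longrightarrow> solution lam kap bc J u\<^sub>0 b\<^sub>0 u b p \<longrightarrow> lagrangian bc J u \<gamma> \<longrightarrow>
       (\<forall>\<alpha>\<in>{0..1}. \<forall>t\<in>J.
          ((\<lambda>a. \<gamma> a t) has_real_derivative
             exp (t * deriv_on (space_dom bc) u\<^sub>0 \<alpha>) *
             inverse (integral {0..1} (\<lambda>a. exp (t * deriv_on (space_dom bc) u\<^sub>0 a)))) (at \<alpha> within {0..1}) \<and>
          b (\<gamma> \<alpha> t) t = b\<^sub>0 \<alpha> \<and>
          0 \<le> deriv_on (space_dom bc) u\<^sub>0 \<alpha> - Dx (space_dom bc) u (\<gamma> \<alpha> t) t \<and>
          deriv_on (space_dom bc) u\<^sub>0 \<alpha> - Dx (space_dom bc) u (\<gamma> \<alpha> t) t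
            \<le> integral {0..1} (\<lambda>a. deriv_on (space_dom bc) u\<^sub>0 a * exp (t * deriv_on (space_dom bc) u\<^sub>0 a))))"
proof (intro conjI allI impI ballI)
  interpret construction bc u\<^sub>0 b\<^sub>0 using assms(3) by unfold_locales
  show "\<exists>u b p \<gamma>. solution lam kap bc {0..} u\<^sub>0 b\<^sub>0 u b p \<and> lagrangian bc {0..} u \<gamma>"
    unfolding assms(1,2) using solution_construction lagrangian_construction by blast
next
  fix J u b p \<gamma> \<alpha> t
  assume J: "lifespan J" and sol: "solution lam kap bc J u\<^sub>0 b\<^sub>0 u b p" and lag: "lagrangian bc J u \<gamma>"
    and \<alpha>: "\<alpha> \<in> {0..1::real}" and t: "t \<in> J"
  interpret solution_with_flow bc u\<^sub>0 b\<^sub>0 J u b p \<gamma>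
    using J sol lag assms by unfold_locales auto
  have v: "deriv_on (space_dom bc) u\<^sub>0 = v" by (simp add: v_def)
  show "((\<lambda>a. \<gamma> a t) has_real_derivative
             exp (t * deriv_on (space_dom bc) u\<^sub>0 \<alpha>) *
             inverse (integral {0..1} (\<lambda>a. exp (t * deriv_on (space_dom bc) u\<^sub>0 a)))) (at \<alpha> within {0..1})"
    using jacobian[OF \<alpha> t] unfolding M_def v .
  show "b (\<gamma> \<alpha> t) t = b\<^sub>0 \<alpha>" using b_along_flow[OF \<alpha> t] .
  show "0 \<le> deriv_on (space_dom bc) u\<^sub>0 \<alpha> - Dx (space_dom bc) u (\<gamma> \<alpha> t) t"
    "deriv_on (space_dom bc) u\<^sub>0 \<alpha> - Dx (space_dom bc) u (\<gamma> \<alpha> t) t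
        \<le> integral {0..1} (\<lambda>a. deriv_on (space_dom bc) u\<^sub>0 a * exp (t * deriv_on (space_dom bc) u\<^sub>0 a))"
    using K_bounds[OF t] unfolding u_x_along_flow[OF \<alpha> t] dM_def v by simp_all
qed

end
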